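(* Fix positive constants $c,G$, an equation of state $P=P(\rho)$ satisfying the standing assumption on the pressure (with $1<\gamma<2$), and a central density $\rho_c>0$. Suppose that the solution of the Tolman-Oppenheimer-Volkoff equation (the case $\Lambda=0$) with central density $\rho_c$ is short. Then there exists a positive number $\epsilon_1$ such that, for every $\Lambda$ with $0<\Lambda\le\epsilon_1$, the solution germ of the Tolman-Oppenheimer-Volkoff-de Sitter equation with cosmological constant $\Lambda$ and with central density $\rho_c$ has a monotone-short prolongation to the right.
   Context: Constants: $c>0$, $G>0$, $\Lambda\ge0$. Standing assumption on the pressure: $P$ is a given function of the density $\rho>0$ with $P>0$ and $0<dP/d\rho<c^2$ for $\rho>0$, and $P\to0$ as $\rho\to+0$; moreover $P=A\rho^{\gamma}\Omega(A\rho^{\gamma-1}/c^2)$ with positive constants $A,\gamma$, $1<\gamma<2$, and $\Omega$ real analytic on a neighborhood of $[0,+\infty)$ with $\Omega(0)=1$. Since $P$ is strictly increasing in $\rho$, $\rho$ is regarded as a function of $P$. Notation: $\kappa(r,m):=1-\frac{2Gm}{c^2r}-\frac{\Lambda}{3}r^2$ and $Q(r,m,P):=G\big(m+\frac{4\pi r^3}{c^2}P\big)-\frac{c^2\Lambda}{3}r^3$. Consider the system $$\frac{dm}{dr}=4\pi r^2\rho,\qquad \frac{dP}{dr}=-(\rho+P/c^2)\frac{Q(r,m,P)}{r^2\kappa(r,m)}$$ on the domain $\mathcal D=\{(r,m,P): 0<r,\ |m|<+\infty,\ 0<\rho,\ 0<\kappa(r,m)\}$. For $\Lambda>0$ it is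 called the Tolman-Oppenheimer-Volkoff-de Sitter equation; for $\Lambda=0$ it is called the Tolman-Oppenheimer-Volkoff equation. Solution germ: given a central density $\rho_c>0$, with $P_c:=P(\rho_c)$, the solution germ at $r=+0$ with central density $\rho_c$ is the solution with $$m=\frac{4\pi}{3}\rho_cr^3+O(r^5),\qquad P=P_c-(\rho_c+P_c/c^2)\big(4\pi G(\rho_c+3P_c/c^2)-c^2\Lambda\big)\frac{r^2}{6}+O(r^4)$$ as $r\to+0$. Its prolongation is its (unique) continuation to the right as long as possible as a solution in $\mathcal D$. Short: the solution of the Tolman-Oppenheimer-Volkoff equation ($\Lambda=0$) with central density $\rho_c$ is short if the prolongation $(m^0(r),P^0(r))$, $0<r<r_+^0$, of its germ has $r_+^0<\infty$ and $P^0(r)\to0$ as $r\to r_+^0-0$. Monotone-short (for $\Lambda>0$): a solution $(m(r),P(r))$, $0<r<r_+$, is monotone-short if $r_+<\infty$, $dP/dr<0$ for $0<r<r_+$, $P\to0$ as $r\to r_+$, and $\kappa_+>0$, $Q_+>0$, where, with $m_+:=\lim_{r\to r_+-0}m(r)$, $$\kappa_+:=\lim_{r\to r_+-0}\kappa(r,m(r))=1-\frac{2Gm_+}{c^2r_+}-\frac{\Lambda}{3}r_+^2,\qquad Q_+:=\lim_{r\to r_+-0}Q(r,m(r),P(r))=Gm_+-\frac{c^2\Lambda}{3}r_+^3.$$ *)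

theory Defs
  imports "HOL-Analysis.Analysis" "HOL-Library.Landau_Symbols"
begin

section \<open>Equation of state\<close>

definition real_analytic_on :: "(real \<Rightarrow> real) \<Rightarrow> real set \<Rightarrow> bool" where
  "real_analytic_on f U \<longleftrightarrow>
     (\<forall>x\<in>U. \<exists>e>0. \<exists>a :: nat \<Rightarrow> real. \<forall>y. \<bar>y - x\<bar> < e \<longrightarrow> (\<lambda>n. a n * (y - x) ^ n) sums f y)"

text \<open>Pressure laws \<open>P\<close> are total functions of the density; only their values on
  \<open>{0<..}\<close> are meaningful. Likewise only the values of \<open>\<Omega>\<close> near \<open>{0..}\<close> matter.\<close>

definition pressure_law ::
    "real \<Rightarrow> real \<Rightarrow> real \<Rightarrow> (real \<Rightarrow> real) \<Rightarrow> (real \<Rightarrow> real) \<Rightarrow> bool" where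
  "pressure_law c A \<gamma> \<Omega> P \<longleftrightarrow>
     (\<forall>\<rho>>0. 0 < P \<rho>) \<and>
     (\<forall>\<rho>>0. \<exists>D. (P has_real_derivative D) (at \<rho>) \<and> 0 < D \<and> D < c\<^sup>2) \<and>
     (P \<longlongrightarrow> 0) (at_right 0) \<and>
     0 < A \<and> 1 < \<gamma> \<and> \<gamma> < 2 \<and>
     (\<exists>U. open U \<and> {0..} \<subseteq> U \<and> real_analytic_on \<Omega> U) \<and> \<Omega> 0 = 1 \<and>
     (\<forall>\<rho>>0. P \<rho> = A * \<rho> powr \<gamma> * \<Omega> (A * \<rho> powr (\<gamma> - 1) / c\<^sup>2))"

definition density_of :: "(real \<Rightarrow> real) \<Rightarrow> real \<Rightarrow> real" where
  "density_of P = the_inv_into {0<..} P"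


section \<open>The Tolman-Oppenheimer-Volkoff-de Sitter equation\<close>

definition tov_kappa :: "real \<Rightarrow> real \<Rightarrow> real \<Rightarrow> real \<Rightarrow> real \<Rightarrow> real" where
  "tov_kappa c G \<Lambda> r m = 1 - 2 * G * m / (c\<^sup>2 * r) - \<Lambda> / 3 * r\<^sup>2"

definition tov_Q :: "real \<Rightarrow> real \<Rightarrow> real \<Rightarrow> real \<Rightarrow> real \<Rightarrow> real \<Rightarrow> real" where
  "tov_Q c G \<Lambda> r m p = G * (m + 4 * pi * r ^ 3 / c\<^sup>2 * p) - c\<^sup>2 * \<Lambda> / 3 * r ^ 3"

text \<open>With the pressure \<open>p\<close> as the unknown, the condition that the density be positive reads
  \<open>p \<in> P ` {0<..}\<close>: these are the pressures for which \<open>density_of P p\<close> is a genuine (and then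
  positive) density.\<close>

definition tov_domain ::
    "real \<Rightarrow> real \<Rightarrow> real \<Rightarrow> (real \<Rightarrow> real) \<Rightarrow> (real \<times> real \<times> real) set" where
  "tov_domain c G \<Lambda> P =
     {(r, m, p). 0 < r \<and> p \<in> P ` {0<..} \<and> 0 < tov_kappa c G \<Lambda> r m}"

text \<open>\<open>R\<close> is the right end of the interval of existence, possibly \<open>\<infinity>\<close>.\<close>

definition tov_solution ::
    "real \<Rightarrow> real \<Rightarrow> real \<Rightarrow> (real \<Rightarrow> real) \<Rightarrow> ereal \<Rightarrow> (real \<Rightarrow> real) \<Rightarrow> (real \<Rightarrow> real) \<Rightarrow> bool" where
  "tov_solution c G \<Lambda> P R m p \<longleftrightarrow> 0 < R \<and>
     (\<forall>r. 0 < r \<and> ereal r < R \<longrightarrow>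
        (r, m r, p r) \<in> tov_domain c G \<Lambda> P \<and>
        (m has_real_derivative 4 * pi * r\<^sup>2 * density_of P (p r)) (at r) \<and>
        (p has_real_derivative
           - (density_of P (p r) + p r / c\<^sup>2)
             * (tov_Q c G \<Lambda> r (m r) (p r) / (r\<^sup>2 * tov_kappa c G \<Lambda> r (m r)))) (at r))"

definition has_central_density ::
    "real \<Rightarrow> real \<Rightarrow> real \<Rightarrow> (real \<Rightarrow> real) \<Rightarrow> real \<Rightarrow> (real \<Rightarrow> real) \<Rightarrow> (real \<Rightarrow> real) \<Rightarrow> bool" where
  "has_central_density c G \<Lambda> P \<rho>c m p \<longleftrightarrow>
     (\<lambda>r. m r - 4 * pi / 3 * \<rho>c * r ^ 3) \<in> O[at_right 0](\<lambda>r. r ^ 5) \<and>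
     (\<lambda>r. p r - (P \<rho>c - (\<rho>c + P \<rho>c / c\<^sup>2)
                 * (4 * pi * G * (\<rho>c + 3 * P \<rho>c / c\<^sup>2) - c\<^sup>2 * \<Lambda>) * (r\<^sup>2 / 6)))
       \<in> O[at_right 0](\<lambda>r. r ^ 4)"

text \<open>The prolongation of the germ at \<open>r = +0\<close> with central density \<open>\<rho>c\<close>, that is, the
  solution with this germ that cannot be continued to the right of \<open>R\<close> inside the domain.\<close>

definition germ_prolongation ::
    "real \<Rightarrow> real \<Rightarrow> real \<Rightarrow> (real \<Rightarrow> real) \<Rightarrow> real \<Rightarrow> ereal \<Rightarrow> (real \<Rightarrow> real) \<Rightarrow> (real \<Rightarrow> real) \<Rightarrow> bool" where
  "germ_prolongation c G \<Lambda> P \<rho>c R m p \<longleftrightarrow>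
     tov_solution c G \<Lambda> P R m p \<and>
     has_central_density c G \<Lambda> P \<rho>c m p \<and>
     \<not> (\<exists>R' m' p'. R < R' \<and> tov_solution c G \<Lambda> P R' m' p' \<and>
          (\<forall>r. 0 < r \<and> ereal r < R \<longrightarrow> m' r = m r \<and> p' r = p r))"

definition short_tov :: "real \<Rightarrow> real \<Rightarrow> (real \<Rightarrow> real) \<Rightarrow> real \<Rightarrow> bool" where
  "short_tov c G P \<rho>c \<longleftrightarrow>
     (\<exists>R m p. germ_prolongation c G 0 P \<rho>c (ereal R) m p \<and> (p \<longlongrightarrow> 0) (at_left R))"

definition monotone_short ::
    "real \<Rightarrow> real \<Rightarrow> real \<Rightarrow> (real \<Rightarrow> real) \<Rightarrow> real \<Rightarrow> (real \<Rightarrow> real) \<Rightarrow> (real \<Rightarrow> real) \<Rightarrow> bool" where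
  "monotone_short c G \<Lambda> P R m p \<longleftrightarrow>
     tov_solution c G \<Lambda> P (ereal R) m p \<and>
     (\<forall>r. 0 < r \<and> r < R \<longrightarrow> deriv p r < 0) \<and>
     (p \<longlongrightarrow> 0) (at_left R) \<and>
     (\<exists>mL \<kappa>L QL.
        (m \<longlongrightarrow> mL) (at_left R) \<and>
        ((\<lambda>r. tov_kappa c G \<Lambda> r (m r)) \<longlongrightarrow> \<kappa>L) (at_left R) \<and> 0 < \<kappa>L \<and>
        ((\<lambda>r. tov_Q c G \<Lambda> r (m r) (p r)) \<longlongrightarrow> QL) (at_left R) \<and> 0 < QL)"

end

(*
  Take theta = A * rho^(gamma - 1) / c^2, the argument of Omega, as the unknown, and write
  m(r) = r^3 w(r) with w(r) = integral over t in [0,1] of 4 pi t^2 rho(theta(r t)).  The system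
  becomes one Volterra equation for theta, regular at r = 0; since 1/(gamma - 1) > 1 it is
  Lipschitz up to the vacuum theta = 0, so it can be continued past the surface with rho = 0
  for theta <= 0.  The solution then depends Lipschitz-continuously on Lambda on a fixed
  interval.  For Lambda = 0 the short star has kappa > 0 up to and including its surface and Q > 0
  throughout, so theta decreases strictly and becomes negative just beyond the surface with
  kappa and Q still positive.  By uniform closeness the same is true for small Lambda > 0, and
  the first zero of theta is the surface of a monotone-short solution.
*)

theory Submission
  imports Defs
begin

text \<open>Clamping \<open>\<theta>\<close> to \<open>{0..\<theta>c}\<close> and replacing \<kappa>
  by \<open>max k \<kappa>\<close> makes the right-hand side globally Lipschitz in the history of
  \<open>\<theta>\<close>, with one constant for all \<open>\<bar>\<Lambda>\<bar> \<le> 1\<close>.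
  Every solution therefore lives on one interval fixed before \<Lambda> is chosen; both
  modifications are later shown to be inactive up to the first zero of \<open>\<theta>\<close>.
  Regularity at the vacuum has a second source besides the exponent of the density: in (\<rho> +
  P/c^2) / (dP/d\<theta>) the density cancels, and the remaining denominator is positive because
  dP/d\<rho> > 0 for positive density and \<Omega>(0) = 1. A short star comes with \<kappa> > 0 only
  before its surface. Positivity at the surface must be proved; it supplies the cut-off level
  \<open>k\<close>. For \<Lambda> = 0 the quantity Q is a sum of a positive mass term and a
  nonnegative pressure term. The mass survives beyond the surface, so \<open>\<theta>\<close> does
  not linger at zero but crosses it, and such a crossing persists under small perturbations. The new
  solutions are maximal because their pressure tends to 0, which no pressure in the domain
  equals.\<close>

section \<open>Real analytic and continuously differentiable functions on intervals\<close>

text \<open>Termwise differentiation of the local power series keeps centre and radius. Applied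
  repeatedly, it makes \<open>\<Omega>\<close> as smooth as the Lipschitz bound for
  \<open>decay\<close> requires: \<open>decay\<close> contains \<open>deriv \<Omega>\<close>, so the
  second derivative must be continuous.\<close>

lemma real_analytic_on_deriv:
  assumes "real_analytic_on f U"
  shows "real_analytic_on (deriv f) U"
    and "x \<in> U \<Longrightarrow> (f has_real_derivative deriv f x) (at x)"
proof -
  have *: "\<exists>e>0. \<exists>a :: nat \<Rightarrow> real. \<forall>y. \<bar>y - x\<bar> < e \<longrightarrow>
      (f has_real_derivative deriv f y) (at y) \<and> (\<lambda>n. a n * (y - x) ^ n) sums deriv f y"
    if "x \<in> U" for x
  proof -
    have "\<exists>e>0. \<exists>a :: nat \<Rightarrow> real. \<forall>y. \<bar>y - x\<bar> < e \<longrightarrow> (\<lambda>n. a n * (y - x) ^ n) sums f y"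
      using assms that unfolding real_analytic_on_def by simp
    then obtain e a where e: "e > 0" and a: "\<And>y. \<bar>y - x\<bar> < e \<Longrightarrow> (\<lambda>n. a n * (y - x) ^ n) sums f y"
      by auto
    have sm: "summable (\<lambda>n. a n * z ^ n)" if "norm z < e" for z :: real
      using a[of "x + z"] that by (auto simp: sums_iff)
    have "(f has_real_derivative deriv f y) (at y)" "(\<lambda>n. diffs a n * (y - x) ^ n) sums deriv f y"
      if y: "\<bar>y - x\<bar> < e" for y
    proof -
      have "((\<lambda>z. \<Sum>n. a n * z ^ n) has_field_derivative (\<Sum>n. diffs a n * (y - x) ^ n)) (at (y - x))"
        by (rule termdiffs_strong'[OF sm]) (use y in auto)
      moreover have "((\<lambda>y. y - x) has_real_derivative 1) (at y)"
        by (auto intro!: derivative_eq_intros)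
      ultimately have "((\<lambda>y. \<Sum>n. a n * (y - x) ^ n) has_real_derivative
          (\<Sum>n. diffs a n * (y - x) ^ n) * 1) (at y)"
        by (rule DERIV_chain2)
      then have D: "(f has_real_derivative (\<Sum>n. diffs a n * (y - x) ^ n)) (at y)"
        unfolding mult_1_right
      proof (rule has_field_derivative_transform_within_open)
        show "open (ball x e)" "y \<in> ball x e"
          using y by (auto simp: dist_real_def)
        show "(\<Sum>n. a n * (z - x) ^ n) = f z" if "z \<in> ball x e" for z
          using a[of z] that by (auto simp: sums_iff dist_real_def abs_minus_commute)
      qed
      have "(\<lambda>n. diffs a n * (y - x) ^ n) sums (\<Sum>n. diffs a n * (y - x) ^ n)"
        by (rule summable_sums, rule termdiff_converges[OF _ sm]) (use y in auto)
      with D show "(f has_real_derivative deriv f y) (at y)" "(\<lambda>n. diffs a n * (y - x) ^ n) sums deriv f y"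
        by (simp_all add: DERIV_imp_deriv)
    qed
    with e show ?thesis by blast
  qed
  show "real_analytic_on (deriv f) U"
    unfolding real_analytic_on_def using * by meson
  show "x \<in> U \<Longrightarrow> (f has_real_derivative deriv f x) (at x)"
    using *[of x] by auto
qed

lemma real_analytic_on_imp_continuous_on:
  assumes "real_analytic_on f U"
  shows "continuous_on U f"
  using real_analytic_on_deriv(2)[OF assms]
  by (meson DERIV_isCont continuous_at_imp_continuous_on)

lemma continuous_on_interval_bounded:
  fixes f :: "real \<Rightarrow> real"
  assumes "continuous_on {a..b} f"
  obtains B where "\<And>x. a \<le> x \<Longrightarrow> x \<le> b \<Longrightarrow> \<bar>f x\<bar> \<le> B"
proof -
  have "bounded (f ` {a..b})"
    by (intro compact_imp_bounded compact_continuous_image assms compact_Icc)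
  then obtain B where "\<forall>z\<in>f ` {a..b}. norm z \<le> B"
    unfolding bounded_iff by blast
  then show ?thesis
    by (intro that[of B]) auto
qed

lemma C1_imp_lipschitz_on_interval:
  fixes f f' :: "real \<Rightarrow> real"
  assumes der: "\<And>x. a \<le> x \<Longrightarrow> x \<le> b \<Longrightarrow> (f has_real_derivative f' x) (at x within {a..b})"
    and cont: "continuous_on {a..b} f'"
  obtains K where "K-lipschitz_on {a..b} f"
proof -
  obtain K where K: "\<And>x. a \<le> x \<Longrightarrow> x \<le> b \<Longrightarrow> \<bar>f' x\<bar> \<le> K"
    by (rule continuous_on_interval_bounded[OF cont]) blast
  have "\<bar>K\<bar>-lipschitz_on {a..b} f"
  proof (rule lipschitz_onI)
    fix x y assume xy: "x \<in> {a..b}" "y \<in> {a..b}"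
    have "norm (f x - f y) \<le> \<bar>K\<bar> * norm (x - y)"
      by (rule field_differentiable_bound[of "{a..b}" f f']) (use xy der order_trans[OF K abs_ge_self] in auto)
    then show "dist (f x) (f y) \<le> \<bar>K\<bar> * dist x y"
      by (simp add: dist_norm)
  qed auto
  then show ?thesis by (rule that)
qed

section \<open>Volterra integral equations\<close>

text \<open>The weight \<open>exp (2 * L * r)\<close> makes the integral operator a contraction with factor \<open>1/2\<close>
  on intervals of any length.\<close>

lemma volterra_weighted_contraction:
  fixes g :: "(real \<Rightarrow> real) \<Rightarrow> real \<Rightarrow> real"
  assumes L: "0 < L"
    and cont: "\<And>u. continuous_on UNIV u \<Longrightarrow> continuous_on {0..T} (g u)"
    and lip: "\<And>u v s E. \<lbrakk>continuous_on UNIV u; continuous_on UNIV v; 0 \<le> s; s \<le> T;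
        \<And>t. 0 \<le> t \<Longrightarrow> t \<le> s \<Longrightarrow> \<bar>u t - v t\<bar> \<le> E\<rbrakk> \<Longrightarrow> \<bar>g u s - g v s\<bar> \<le> L * E"
    and u: "continuous_on UNIV u" and v: "continuous_on UNIV v"
    and r: "0 \<le> r" "r \<le> T" and d: "0 \<le> d"
    and uv: "\<And>t. 0 \<le> t \<Longrightarrow> t \<le> r \<Longrightarrow> \<bar>u t - v t\<bar> \<le> exp (2 * L * t) * d"
  shows "\<bar>integral {0..r} (g u) - integral {0..r} (g v)\<bar> \<le> exp (2 * L * r) * d / 2"
proof -
  have int: "g w integrable_on {0..r}" if "continuous_on UNIV w" for w
    by (rule integrable_continuous_interval, rule continuous_on_subset[OF cont[OF that]]) (use r in auto)
  have der: "((\<lambda>s. exp (2 * L * s) * d / 2) has_vector_derivative L * (exp (2 * L * s) * d)) (at s within {0..r})" for s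
    unfolding has_real_derivative_iff_has_vector_derivative[symmetric]
    by (auto intro!: derivative_eq_intros)
  have hi: "((\<lambda>s. L * (exp (2 * L * s) * d)) has_integral (exp (2 * L * r) * d / 2 - exp (2 * L * 0) * d / 2)) {0..r}"
    by (rule fundamental_theorem_of_calculus) (use r der in auto)
  have "norm (integral {0..r} (\<lambda>s. g u s - g v s)) \<le> integral {0..r} (\<lambda>s. L * (exp (2 * L * s) * d))"
  proof (rule integral_norm_bound_integral)
    show "(\<lambda>s. g u s - g v s) integrable_on {0..r}"
      by (intro integrable_diff int u v)
    show "(\<lambda>s. L * (exp (2 * L * s) * d)) integrable_on {0..r}"
      using hi by (rule has_integral_integrable)
    fix s assume s: "s \<in> {0..r}"
    \<comment> \<open>The condition \<open>lip\<close> is nonlocal and asks for one bound on all of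
      \<open>{0..s}\<close>. The weight increases, so its value at \<open>s\<close> is such a
      bound.\<close>
    have "\<bar>u t - v t\<bar> \<le> exp (2 * L * s) * d" if "0 \<le> t" "t \<le> s" for t
    proof -
      have "\<bar>u t - v t\<bar> \<le> exp (2 * L * t) * d"
        using uv that s by auto
      also have "\<dots> \<le> exp (2 * L * s) * d"
        using that L d by (intro mult_right_mono) auto
      finally show ?thesis .
    qed
    then show "norm (g u s - g v s) \<le> L * (exp (2 * L * s) * d)"
      using lip[OF u v, of s] s r by auto
  qed
  also have "\<dots> \<le> exp (2 * L * r) * d / 2"
    using integral_unique[OF hi] d by simp
  also have "integral {0..r} (\<lambda>s. g u s - g v s) = integral {0..r} (g u) - integral {0..r} (g v)"
    by (rule integral_diff[OF int[OF u] int[OF v]])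
  finally show ?thesis by simp
qed

text \<open>Banach's fixed point theorem. The value \<open>g u s\<close> may depend on
  \<open>u\<close> on all of \<open>{0..s}\<close>, as the enclosed mass does, so this is a Volterra
  equation rather than an ordinary differential equation.\<close>

lemma volterra_exists:
  fixes g :: "(real \<Rightarrow> real) \<Rightarrow> real \<Rightarrow> real"
  assumes T: "0 \<le> T" and L: "0 < L"
    and cont: "\<And>u. continuous_on UNIV u \<Longrightarrow> continuous_on {0..T} (g u)"
    and lip: "\<And>u v s E. \<lbrakk>continuous_on UNIV u; continuous_on UNIV v; 0 \<le> s; s \<le> T;
        \<And>t. 0 \<le> t \<Longrightarrow> t \<le> s \<Longrightarrow> \<bar>u t - v t\<bar> \<le> E\<rbrakk> \<Longrightarrow> \<bar>g u s - g v s\<bar> \<le> L * E"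
  obtains u where "continuous_on UNIV u"
    and "\<And>r. 0 \<le> r \<Longrightarrow> r \<le> T \<Longrightarrow> u r = a + integral {0..r} (g u)"
proof -
  \<comment> \<open>Freezing the argument outside \<open>{0..T}\<close> makes \<open>F\<close> a
    self-map of the bounded continuous functions on the line. The unknown is the solution divided by
    the weight, which \<open>W\<close> restores, so the ordinary sup distance plays the role of the
    weighted one.\<close>
  define cl where "cl r = max 0 (min T r)" for r :: real
  define W where "W y t = exp (2 * L * t) * apply_bcontfun y t" for y :: "real \<Rightarrow>\<^sub>C real" and t
  define F where "F y r = exp (- (2 * L * cl r)) * (a + integral {0..cl r} (g (W y)))" for y r
  have cl: "0 \<le> cl r" "cl r \<le> T" for r
    using T by (auto simp: cl_def)
  have contW: "continuous_on UNIV (W y)" for y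
    unfolding W_def by (intro continuous_intros) simp
  have FB: "F y \<in> bcontfun" for y
  proof -
    let ?h = "\<lambda>r. exp (- (2 * L * r)) * (a + integral {0..r} (g (W y)))"
    have h: "continuous_on {0..T} ?h"
      by (intro continuous_intros indefinite_integral_continuous_1 integrable_continuous_interval
          cont contW)
    have "continuous_on UNIV (\<lambda>r. ?h (cl r))"
      by (rule continuous_on_compose2[OF h]) (use cl in \<open>auto simp: cl_def intro!: continuous_intros\<close>)
    moreover have "bounded (?h ` {0..T})"
      by (intro compact_imp_bounded compact_continuous_image h compact_Icc)
    then have "bounded (range (\<lambda>r. ?h (cl r)))"
      by (rule bounded_subset) (use cl in auto)
    ultimately show ?thesis
      by (simp add: bcontfun_def F_def)
  qed
  have "\<exists>!y. Bcontfun (F y) = y"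
  proof (rule banach_fix_type[of "1/2"])
    show "\<forall>y z. dist (Bcontfun (F y)) (Bcontfun (F z)) \<le> 1/2 * dist y z"
    proof (intro allI dist_bound)
      fix y z r
      let ?I = "\<lambda>y. integral {0..cl r} (g (W y))"
      have "\<bar>?I y - ?I z\<bar> \<le> exp (2 * L * cl r) * dist y z / 2"
      proof (rule volterra_weighted_contraction[OF L cont lip])
        fix t
        have "\<bar>W y t - W z t\<bar> = exp (2 * L * t) * dist (y t) (z t)"
          by (simp add: W_def dist_real_def abs_mult flip: right_diff_distrib)
        also have "\<dots> \<le> exp (2 * L * t) * dist y z"
          by (intro mult_left_mono dist_bounded) auto
        finally show "\<bar>W y t - W z t\<bar> \<le> exp (2 * L * t) * dist y z" .
      qed (use cl contW in auto)
      then have "exp (- (2 * L * cl r)) * \<bar>?I y - ?I z\<bar>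
          \<le> exp (- (2 * L * cl r)) * (exp (2 * L * cl r) * dist y z / 2)"
        by (intro mult_left_mono) auto
      also have "\<dots> = dist y z / 2"
        by (simp add: exp_minus field_simps)
      also have "exp (- (2 * L * cl r)) * \<bar>?I y - ?I z\<bar> = dist (F y r) (F z r)"
        by (simp add: F_def dist_real_def abs_mult flip: right_diff_distrib)
      finally show "dist (apply_bcontfun (Bcontfun (F y)) r) (apply_bcontfun (Bcontfun (F z)) r) \<le> 1/2 * dist y z"
        by (simp add: Bcontfun_inverse FB)
    qed
  qed auto
  then obtain y where y: "Bcontfun (F y) = y" by auto
  show ?thesis
  proof
    show "continuous_on UNIV (W y)" by (rule contW)
    fix r assume r: "0 \<le> r" "r \<le> T"
    then have "cl r = r" by (auto simp: cl_def)
    have "apply_bcontfun y r = F y r"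
      using Bcontfun_inverse[OF FB[of y]] y by simp
    then show "W y r = a + integral {0..r} (g (W y))"
      by (subst W_def) (simp add: F_def \<open>cl r = r\<close> exp_minus)
  qed
qed

text \<open>Let \<open>N\<close> be the maximum of the weighted difference, attained at
  \<open>q\<close>. The contraction estimate at \<open>q\<close> gives
  \<open>N \<le> N / 2 + e * T\<close>, and the first term is absorbed on the left. The case
  \<open>e = 0\<close> is uniqueness.\<close>

lemma volterra_stability:
  fixes g h :: "(real \<Rightarrow> real) \<Rightarrow> real \<Rightarrow> real"
  assumes T: "0 \<le> T" and L: "0 < L"
    and cont: "\<And>u. continuous_on UNIV u \<Longrightarrow> continuous_on {0..T} (g u)"
    and lip: "\<And>u v s E. \<lbrakk>continuous_on UNIV u; continuous_on UNIV v; 0 \<le> s; s \<le> T;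
        \<And>t. 0 \<le> t \<Longrightarrow> t \<le> s \<Longrightarrow> \<bar>u t - v t\<bar> \<le> E\<rbrakk> \<Longrightarrow> \<bar>g u s - g v s\<bar> \<le> L * E"
    and u: "continuous_on UNIV u" and v: "continuous_on UNIV v"
    and hv: "continuous_on {0..T} (h v)"
    and ueq: "\<And>r. 0 \<le> r \<Longrightarrow> r \<le> T \<Longrightarrow> u r = a + integral {0..r} (g u)"
    and veq: "\<And>r. 0 \<le> r \<Longrightarrow> r \<le> T \<Longrightarrow> v r = a + integral {0..r} (h v)"
    and gh: "\<And>s. 0 \<le> s \<Longrightarrow> s \<le> T \<Longrightarrow> \<bar>g v s - h v s\<bar> \<le> e"
    and r: "0 \<le> r" "r \<le> T"
  shows "\<bar>u r - v r\<bar> \<le> 2 * e * T * exp (2 * L * T)"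
proof -
  let ?d = "\<lambda>r. exp (- (2 * L * r)) * \<bar>u r - v r\<bar>"
  have "continuous_on {0..T} ?d"
    by (intro continuous_intros continuous_on_subset[OF u] continuous_on_subset[OF v]) auto
  then obtain q where q: "0 \<le> q" "q \<le> T" and qmax: "\<And>t. 0 \<le> t \<Longrightarrow> t \<le> T \<Longrightarrow> ?d t \<le> ?d q"
    using continuous_attains_sup[of "{0..T}" ?d] T by auto
  define N where "N = ?d q"
  have N: "\<bar>u t - v t\<bar> \<le> exp (2 * L * t) * N" if "0 \<le> t" "t \<le> T" for t
    using qmax[OF that] unfolding N_def[symmetric] by (simp add: exp_minus field_simps)
  have e0: "0 \<le> e"
    using gh[of 0] T by auto
  have N0: "0 \<le> N" by (simp add: N_def)
  have "\<bar>integral {0..q} (g u) - integral {0..q} (g v)\<bar> \<le> exp (2 * L * q) * N / 2"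
    by (rule volterra_weighted_contraction[OF L cont lip u v q N0]) (use N q in auto)
  moreover have "\<bar>integral {0..q} (g v) - integral {0..q} (h v)\<bar> \<le> e * T"
  proof -
    have int: "f integrable_on {0..q}" if "continuous_on {0..T} f" for f :: "real \<Rightarrow> real"
      by (rule integrable_continuous_interval, rule continuous_on_subset[OF that]) (use q in auto)
    have "norm (integral {0..q} (\<lambda>s. g v s - h v s)) \<le> integral {0..q} (\<lambda>s. e)"
      by (rule integral_norm_bound_integral) (use gh q in \<open>auto intro!: int continuous_on_diff cont v hv\<close>)
    also have "\<dots> = e * q"
      using q by simp
    also have "\<dots> \<le> e * T"
      by (rule mult_left_mono[OF q(2) e0])
    finally show ?thesis
      by (simp add: integral_diff int cont v hv)
  qed
  ultimately have "\<bar>u q - v q\<bar> \<le> exp (2 * L * q) * N / 2 + e * T"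
    using ueq[OF q] veq[OF q] by linarith
  then have "N \<le> exp (- (2 * L * q)) * (exp (2 * L * q) * N / 2 + e * T)"
    unfolding N_def by (intro mult_left_mono) auto
  also have "\<dots> = N / 2 + exp (- (2 * L * q)) * (e * T)"
    by (simp add: exp_minus field_simps)
  also have "\<dots> \<le> N / 2 + 1 * (e * T)"
    using q L e0 T by (intro add_left_mono mult_right_mono) auto
  finally have "N \<le> 2 * e * T" by simp
  have "\<bar>u r - v r\<bar> \<le> exp (2 * L * r) * N"
    by (rule N[OF r])
  also have "\<dots> \<le> exp (2 * L * T) * (2 * e * T)"
    using r L N0 \<open>N \<le> 2 * e * T\<close> by (intro mult_mono) auto
  finally show ?thesis by (simp add: mult_ac)
qed

section \<open>The rescaled mass\<close>

text \<open>For a density profile \<open>f\<close>, the enclosed mass is \<open>m r = r ^ 3 * scaled_mass f r\<close>; unlike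
  \<open>m r / r ^ 3\<close> the integral is regular at the centre.\<close>

definition scaled_mass :: "(real \<Rightarrow> real) \<Rightarrow> real \<Rightarrow> real" where
  "scaled_mass f s = integral {0..1} (\<lambda>t. 4 * pi * t\<^sup>2 * f (s * t))"

context
  fixes f :: "real \<Rightarrow> real"
  assumes f: "continuous_on UNIV f"
begin

lemma continuous_on_scaled_mass_integrand:
  "continuous_on {0..1} (\<lambda>t. 4 * pi * t\<^sup>2 * f (s * t))"
  by (intro continuous_intros continuous_on_compose2[OF f]) auto

lemma continuous_on_scaled_mass: "continuous_on X (scaled_mass f)"
proof -
  have "continuous_on (UNIV \<times> cbox 0 1) (\<lambda>(s, t). 4 * pi * t\<^sup>2 * f (s * t))"
    unfolding case_prod_beta
    by (intro continuous_intros continuous_on_compose2[OF f]) auto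
  from integral_continuous_on_param[OF this]
  have "continuous_on UNIV (scaled_mass f)"
    unfolding scaled_mass_def[abs_def] by (simp add: cbox_interval)
  then show ?thesis by (rule continuous_on_subset) simp
qed

lemma scaled_mass_at_0: "scaled_mass f 0 = 4 * pi / 3 * f 0"
proof -
  have "((\<lambda>t. 4 * pi * t\<^sup>2 * f 0) has_integral (4 * pi / 3 * 1 ^ 3 * f 0 - 4 * pi / 3 * 0 ^ 3 * f 0)) {0..1}"
    by (rule fundamental_theorem_of_calculus)
      (auto simp: has_real_derivative_iff_has_vector_derivative[symmetric] intro!: derivative_eq_intros)
  from integral_unique[OF this] show ?thesis
    by (simp add: scaled_mass_def)
qed

text \<open>The substitution of \<open>s * t\<close> for \<open>t\<close>, done by applying the
  fundamental theorem of calculus to \<open>?I (s * t)\<close> as a function of \<open>t\<close>;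
  this covers \<open>s = 0\<close> as well.\<close>

lemma scaled_mass_eq_integral:
  assumes s: "0 \<le> s"
  shows "s ^ 3 * scaled_mass f s = integral {0..s} (\<lambda>t. 4 * pi * t\<^sup>2 * f t)"
proof -
  let ?h = "\<lambda>t. 4 * pi * t\<^sup>2 * f t"
  let ?I = "\<lambda>r. integral {0..r} ?h"
  have h: "continuous_on {0..s} ?h"
    by (intro continuous_intros continuous_on_subset[OF f]) auto
  have I: "(?I has_real_derivative ?h t) (at t within {0..s})" if "t \<in> {0..s}" for t
    by (rule integral_has_real_derivative[OF h that])
  have "((\<lambda>t. ?h (s * t) * s) has_integral (?I (s * 1) - ?I (s * 0))) {0..1}"
  proof (rule fundamental_theorem_of_calculus)
    fix t :: real assume t: "t \<in> {0..1}"
    have "(?I has_real_derivative ?h (s * t)) (at (s * t) within (\<lambda>t. s * t) ` {0..1})"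
      by (rule DERIV_subset[OF I]) (use t s in \<open>auto simp: mult_left_le\<close>)
    then have "((\<lambda>t. ?I (s * t)) has_real_derivative ?h (s * t) * s) (at t within {0..1})"
      by (rule DERIV_image_chain[unfolded o_def]) (auto intro!: derivative_eq_intros)
    then show "((\<lambda>t. ?I (s * t)) has_vector_derivative ?h (s * t) * s) (at t within {0..1})"
      by (simp add: has_real_derivative_iff_has_vector_derivative)
  qed simp
  from integral_unique[OF this] have "integral {0..1} (\<lambda>t. ?h (s * t) * s) = ?I s"
    by simp
  moreover have "(\<lambda>t. ?h (s * t) * s) = (\<lambda>t. s ^ 3 * (4 * pi * t\<^sup>2 * f (s * t)))"
    by (auto simp: power2_eq_square power3_eq_cube)
  ultimately show ?thesis
    by (simp add: scaled_mass_def)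
qed

lemma has_real_derivative_scaled_mass:
  assumes s: "0 < s"
  shows "((\<lambda>r. r ^ 3 * scaled_mass f r) has_real_derivative 4 * pi * s\<^sup>2 * f s) (at s)"
proof (rule has_field_derivative_transform_within_open)
  have "((\<lambda>r. integral {0..r} (\<lambda>t. 4 * pi * t\<^sup>2 * f t)) has_real_derivative 4 * pi * s\<^sup>2 * f s)
      (at s within {0..s + 1})"
    by (rule integral_has_real_derivative)
      (use s in \<open>auto intro!: continuous_intros continuous_on_subset[OF f]\<close>)
  then show "((\<lambda>r. integral {0..r} (\<lambda>t. 4 * pi * t\<^sup>2 * f t)) has_real_derivative 4 * pi * s\<^sup>2 * f s) (at s)"
    using s by (simp add: at_within_Icc_at)
  show "open {0::real<..}" "s \<in> {0<..}" using s by auto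
qed (auto simp: scaled_mass_eq_integral)

lemma scaled_mass_abs_le:
  assumes "0 \<le> s" and E: "\<And>t. 0 \<le> t \<Longrightarrow> t \<le> s \<Longrightarrow> \<bar>f t\<bar> \<le> E"
  shows "\<bar>scaled_mass f s\<bar> \<le> 4 * pi / 3 * E"
proof -
  have hi: "((\<lambda>t. 4 * pi * t\<^sup>2 * E) has_integral (4 * pi / 3 * 1 ^ 3 * E - 4 * pi / 3 * 0 ^ 3 * E)) {0..1}"
    by (rule fundamental_theorem_of_calculus)
      (auto simp: has_real_derivative_iff_has_vector_derivative[symmetric] intro!: derivative_eq_intros)
  have "norm (scaled_mass f s) \<le> integral {0..1} (\<lambda>t. 4 * pi * t\<^sup>2 * E)"
    unfolding scaled_mass_def
  proof (rule integral_norm_bound_integral)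
    show "norm (4 * pi * t\<^sup>2 * f (s * t)) \<le> 4 * pi * t\<^sup>2 * E" if "t \<in> {0..1}" for t
      using E[of "s * t"] that \<open>0 \<le> s\<close> by (auto simp: abs_mult mult_left_le intro!: mult_left_mono)
  qed (use has_integral_integrable[OF hi] in
      \<open>auto intro: integrable_continuous_interval continuous_on_scaled_mass_integrand\<close>)
  also have "\<dots> = 4 * pi / 3 * E"
    unfolding integral_unique[OF hi] by simp
  finally show ?thesis by simp
qed

text \<open>If the integral vanished, so would its nonnegative continuous integrand, giving
  \<open>f (s * t) = 0\<close> for \<open>0 < t \<le> 1\<close>; letting \<open>t\<close> tend to 0
  contradicts \<open>0 < f 0\<close>. Positivity thus comes from the centre alone and extends past
  the surface.\<close>

lemma scaled_mass_pos:
  assumes nonneg: "\<And>t. 0 \<le> f t" and pos: "0 < f 0"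
  shows "0 < scaled_mass f s"
proof -
  let ?h = "\<lambda>t. 4 * pi * t\<^sup>2 * f (s * t)"
  have "scaled_mass f s \<ge> 0"
    unfolding scaled_mass_def by (rule integral_nonneg)
      (auto intro!: integrable_continuous_interval continuous_on_scaled_mass_integrand mult_nonneg_nonneg nonneg)
  moreover have "scaled_mass f s \<noteq> 0"
  proof
    assume "scaled_mass f s = 0"
    then have z: "?h t = 0" if "t \<in> {0..1}" for t
      using integral_eq_0_iff[OF continuous_on_scaled_mass_integrand[of s]] that nonneg
      by (simp add: scaled_mass_def)
    have fz: "f (s * t) = 0" if "t \<in> {0<..1}" for t
      using z[of t] that by auto
    have "((\<lambda>t. f (s * t)) \<longlongrightarrow> f (s * 0)) (at_right 0)"
      by (rule continuous_on_tendsto_compose[OF f]) (auto intro!: tendsto_eq_intros)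
    moreover have "((\<lambda>t. f (s * t)) \<longlongrightarrow> 0) (at_right 0)"
      by (rule tendsto_eventually, rule eventually_at_rightI[of _ 1]) (use fz in auto)
    ultimately show False
      using pos tendsto_unique[OF trivial_limit_at_right_real] by fastforce
  qed
  ultimately show ?thesis by simp
qed

end

lemma scaled_mass_diff_le:
  assumes "continuous_on UNIV f" "continuous_on UNIV g"
    and "0 \<le> s" "\<And>t. 0 \<le> t \<Longrightarrow> t \<le> s \<Longrightarrow> \<bar>f t - g t\<bar> \<le> E"
  shows "\<bar>scaled_mass f s - scaled_mass g s\<bar> \<le> 4 * pi / 3 * E"
proof -
  have "scaled_mass f s - scaled_mass g s = scaled_mass (\<lambda>t. f t - g t) s"
    unfolding scaled_mass_def
    by (subst integral_diff[symmetric])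
      (auto simp: right_diff_distrib intro!: integrable_continuous_interval
        continuous_on_scaled_mass_integrand assms)
  then show ?thesis
    using scaled_mass_abs_le[of "\<lambda>t. f t - g t" s E] assms by (auto intro!: continuous_on_diff)
qed

section \<open>Equation of state\<close>

text \<open>The derivative \<open>a * x powr (a - 1)\<close> is largest at the right end because
  \<open>1 \<le> a\<close>. The power rule wants a positive base, so an endpoint 0 is treated
  through the factorisation \<open>x powr (a - 1) * x\<close>.\<close>

lemma powr_lipschitz_on:
  fixes a b :: real
  assumes a: "1 \<le> a"
  shows "(a * b powr (a - 1))-lipschitz_on {0..b} (\<lambda>x. x powr a)"
proof -
  have L: "\<bar>x powr a - y powr a\<bar> \<le> a * b powr (a - 1) * \<bar>x - y\<bar>"
    if "0 \<le> y" "y < x" "x \<le> b" for x y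
  proof (cases "y = 0")
    case True
    have "x powr a = x powr (a - 1) * x"
      using that by (simp add: powr_diff)
    also have "\<dots> \<le> b powr (a - 1) * x"
      using that a by (intro mult_right_mono powr_mono2) auto
    also have "\<dots> \<le> a * (b powr (a - 1) * x)"
      using mult_right_mono[OF a, of "b powr (a - 1) * x"] that by simp
    finally show ?thesis
      using that a True by (simp add: mult.assoc)
  next
    case False
    have "norm (x powr a - y powr a) \<le> a * b powr (a - 1) * norm (x - y)"
    proof (rule field_differentiable_bound[of "{y..x}" "\<lambda>x. x powr a" "\<lambda>x. a * x powr (a - 1)"])
      fix z assume z: "z \<in> {y..x}"
      show "((\<lambda>x. x powr a) has_real_derivative a * z powr (a - 1)) (at z within {y..x})"
        using z that False by (auto intro!: derivative_eq_intros simp: powr_diff field_simps)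
      show "norm (a * z powr (a - 1)) \<le> a * b powr (a - 1)"
        using z that a False by (auto simp: abs_mult intro!: mult_left_mono powr_mono2)
    qed (use that in auto)
    then show ?thesis by simp
  qed
  have sym: "\<bar>x powr a - y powr a\<bar> \<le> a * b powr (a - 1) * \<bar>x - y\<bar>"
    if "0 \<le> y" "0 \<le> x" "x \<le> b" "y \<le> b" for x y
    using L[of y x] L[of x y] that
    by (cases x y rule: linorder_cases) (simp_all add: abs_minus_commute)
  show ?thesis
    by (rule lipschitz_onI) (use sym a in \<open>auto simp: dist_real_def\<close>)
qed

lemma abs_mult_diff_le:
  fixes a b a' b' :: real
  assumes "\<bar>a\<bar> \<le> A" "\<bar>b'\<bar> \<le> B" "\<bar>a - a'\<bar> \<le> X" "\<bar>b - b'\<bar> \<le> Y"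
  shows "\<bar>a * b - a' * b'\<bar> \<le> A * Y + X * B"
proof -
  have "a * b - a' * b' = a * (b - b') + (a - a') * b'"
    by (simp add: algebra_simps)
  then have "\<bar>a * b - a' * b'\<bar> \<le> \<bar>a\<bar> * \<bar>b - b'\<bar> + \<bar>a - a'\<bar> * \<bar>b'\<bar>"
    by (metis abs_mult abs_triangle_ineq)
  also have "\<dots> \<le> A * Y + X * B"
    using assms by (intro add_mono mult_mono) auto
  finally show ?thesis .
qed

lemma lipschitz_on_interval_mult:
  fixes f g :: "real \<Rightarrow> real"
  assumes f: "K-lipschitz_on {a..b} f" and g: "M-lipschitz_on {a..b} g"
  obtains N where "N-lipschitz_on {a..b} (\<lambda>x. f x * g x)"
proof -
  obtain B where B: "\<And>x. a \<le> x \<Longrightarrow> x \<le> b \<Longrightarrow> \<bar>f x\<bar> \<le> B"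
    by (rule continuous_on_interval_bounded[OF lipschitz_on_continuous_on[OF f]]) blast
  obtain C where C: "\<And>x. a \<le> x \<Longrightarrow> x \<le> b \<Longrightarrow> \<bar>g x\<bar> \<le> C"
    by (rule continuous_on_interval_bounded[OF lipschitz_on_continuous_on[OF g]]) blast
  have "(\<bar>B\<bar> * M + K * \<bar>C\<bar>)-lipschitz_on {a..b} (\<lambda>x. f x * g x)"
  proof (rule lipschitz_onI)
    fix x y assume xy: "x \<in> {a..b}" "y \<in> {a..b}"
    have "\<bar>f x * g x - f y * g y\<bar> \<le> \<bar>B\<bar> * (M * \<bar>x - y\<bar>) + K * \<bar>x - y\<bar> * \<bar>C\<bar>"
      by (rule abs_mult_diff_le)
        (use B[of x] C[of y] xy lipschitz_onD[OF f xy] lipschitz_onD[OF g xy] in \<open>auto simp: dist_real_def\<close>)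
    then show "dist (f x * g x) (f y * g y) \<le> (\<bar>B\<bar> * M + K * \<bar>C\<bar>) * dist x y"
      by (simp add: dist_real_def algebra_simps)
  qed (use lipschitz_on_nonneg[OF f] lipschitz_on_nonneg[OF g] in auto)
  then show ?thesis by (rule that)
qed

locale star =
  fixes c G A \<gamma> \<rho>c :: real and \<Omega> P :: "real \<Rightarrow> real"
  assumes c_pos: "0 < c" and G_pos: "0 < G"
    and law: "pressure_law c A \<gamma> \<Omega> P"
    and \<rho>c_pos: "0 < \<rho>c"
begin

text \<open>The unknown of the regularised system is \<open>\<theta> = A * \<rho> powr (\<gamma> - 1) / c\<^sup>2\<close>, the argument
  of \<open>\<Omega>\<close>. As a function of \<open>\<theta>\<close> the density is a power with exponent \<open>1 / (\<gamma> - 1) > 1\<close>, hence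
  Lipschitz up to the vacuum \<open>\<theta> = 0\<close>; as a function of the pressure it is not.\<close>

definition dens :: "real \<Rightarrow> real" where
  "dens \<theta> = (c\<^sup>2 * \<theta> / A) powr (1 / (\<gamma> - 1))"

text \<open>This is P composed with \<open>dens\<close>: \<open>A * \<rho> powr \<gamma>\<close>
  splits into \<open>A * \<rho> powr (\<gamma> - 1)\<close>, which is
  \<open>c\<^sup>2 * \<theta>\<close>, and one more factor \<rho>.\<close>

definition press :: "real \<Rightarrow> real" where
  "press \<theta> = c\<^sup>2 * \<theta> * dens \<theta> * \<Omega> \<theta>"

text \<open>For positive \<open>\<theta>\<close>, dP/d\<rho> equals
  \<open>c\<^sup>2 * \<theta> * stiff \<theta>\<close>. Dividing out the factor that vanishes at the
  vacuum leaves a function with the positive value \<gamma> at 0.\<close>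

definition stiff :: "real \<Rightarrow> real" where
  "stiff \<theta> = \<gamma> * \<Omega> \<theta> + (\<gamma> - 1) * \<theta> * deriv \<Omega> \<theta>"

text \<open>\<open>(dens + press / c\<^sup>2) / (d press / d \<theta>)\<close>, with the common factor \<open>dens\<close> cancelled.\<close>

definition decay :: "real \<Rightarrow> real" where
  "decay \<theta> = (\<gamma> - 1) / c\<^sup>2 * ((1 + \<theta> * \<Omega> \<theta>) / stiff \<theta>)"

definition theta_of :: "real \<Rightarrow> real" where
  "theta_of \<rho> = A * \<rho> powr (\<gamma> - 1) / c\<^sup>2"

definition \<theta>c :: real where
  "\<theta>c = theta_of \<rho>c"

lemma A_pos: "0 < A" and gamma: "1 < \<gamma>" "\<gamma> < 2"
  and P_pos: "0 < \<rho> \<Longrightarrow> 0 < P \<rho>"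
  and \<Omega>_0: "\<Omega> 0 = 1"
  and P_eq: "0 < \<rho> \<Longrightarrow> P \<rho> = A * \<rho> powr \<gamma> * \<Omega> (theta_of \<rho>)"
  and P_deriv: "0 < \<rho> \<Longrightarrow> \<exists>D. (P has_real_derivative D) (at \<rho>) \<and> 0 < D"
  and \<Omega>_analytic: "\<exists>U. {0..} \<subseteq> U \<and> real_analytic_on \<Omega> U"
  using law by (auto simp: pressure_law_def theta_of_def)

lemma \<Omega>_deriv: "0 \<le> \<theta> \<Longrightarrow> (\<Omega> has_real_derivative deriv \<Omega> \<theta>) (at \<theta>)"
  and \<Omega>_deriv2: "0 \<le> \<theta> \<Longrightarrow> (deriv \<Omega> has_real_derivative deriv (deriv \<Omega>) \<theta>) (at \<theta>)"
  and \<Omega>_cont: "continuous_on {0..} \<Omega>" "continuous_on {0..} (deriv \<Omega>)"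
    "continuous_on {0..} (deriv (deriv \<Omega>))"
proof -
  obtain U where U: "{0..} \<subseteq> U" "real_analytic_on \<Omega> U"
    using \<Omega>_analytic by blast
  note d1 = real_analytic_on_deriv(1)[OF U(2)]
  note d2 = real_analytic_on_deriv(1)[OF d1]
  show "0 \<le> \<theta> \<Longrightarrow> (\<Omega> has_real_derivative deriv \<Omega> \<theta>) (at \<theta>)"
    "0 \<le> \<theta> \<Longrightarrow> (deriv \<Omega> has_real_derivative deriv (deriv \<Omega>) \<theta>) (at \<theta>)"
    using real_analytic_on_deriv(2)[OF U(2)] real_analytic_on_deriv(2)[OF d1] U(1) by auto
  show "continuous_on {0..} \<Omega>" "continuous_on {0..} (deriv \<Omega>)"
    "continuous_on {0..} (deriv (deriv \<Omega>))"
    using U(2) d1 d2 real_analytic_on_imp_continuous_on continuous_on_subset[OF _ U(1)] by blast+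
qed

lemma \<theta>c_pos: "0 < \<theta>c"
  using A_pos c_pos \<rho>c_pos by (simp add: \<theta>c_def theta_of_def)

lemma press_0 [simp]: "press 0 = 0"
  by (simp add: press_def)

lemma dens_pos: "0 < \<theta> \<Longrightarrow> 0 < dens \<theta>"
  using A_pos c_pos by (simp add: dens_def)

lemma dens_nonneg: "0 \<le> dens \<theta>"
  by (simp add: dens_def)

lemma dens_theta_of: "0 < \<rho> \<Longrightarrow> dens (theta_of \<rho>) = \<rho>"
  using A_pos c_pos gamma by (simp add: dens_def theta_of_def powr_powr)

lemma theta_of_dens: "0 < \<theta> \<Longrightarrow> theta_of (dens \<theta>) = \<theta>"
  using A_pos c_pos gamma by (simp add: dens_def theta_of_def powr_powr)

lemma theta_of_pos: "0 < \<rho> \<Longrightarrow> 0 < theta_of \<rho>"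
  using A_pos c_pos by (simp add: theta_of_def)

lemma dens_\<theta>c: "dens \<theta>c = \<rho>c"
  using dens_theta_of \<rho>c_pos by (simp add: \<theta>c_def)

lemma press_eq: "0 < \<theta> \<Longrightarrow> press \<theta> = P (dens \<theta>)"
proof -
  assume \<theta>: "0 < \<theta>"
  have "A * dens \<theta> powr \<gamma> = A * dens \<theta> powr (\<gamma> - 1) * dens \<theta>"
    using dens_pos[OF \<theta>] by (simp add: powr_diff)
  also have "A * dens \<theta> powr (\<gamma> - 1) = c\<^sup>2 * \<theta>"
    using theta_of_dens[OF \<theta>] c_pos by (simp add: theta_of_def field_simps)
  finally show ?thesis
    using P_eq[OF dens_pos[OF \<theta>]] theta_of_dens[OF \<theta>] by (simp add: press_def)
qed

text \<open>The sign is inherited from the pressure: for \<open>0 < \<theta>\<close> all other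
  factors of \<open>press\<close> are positive.\<close>

lemma \<Omega>_pos: "0 \<le> \<theta> \<Longrightarrow> 0 < \<Omega> \<theta>"
proof (cases "\<theta> = 0")
  case False
  assume "0 \<le> \<theta>"
  with False have \<theta>: "0 < \<theta>" by simp
  then have "0 < press \<theta>"
    using P_pos dens_pos press_eq by simp
  moreover have "0 < c\<^sup>2 * \<theta> * dens \<theta>"
    using dens_pos[OF \<theta>] \<theta> c_pos by simp
  ultimately show ?thesis
    unfolding press_def by (rule zero_less_mult_pos)
qed (simp add: \<Omega>_0)

lemma dens_deriv:
  assumes "0 < \<theta>"
  shows "(dens has_real_derivative dens \<theta> / ((\<gamma> - 1) * \<theta>)) (at \<theta>)"
proof -
  let ?a = "1 / (\<gamma> - 1)" and ?x = "c\<^sup>2 * \<theta> / A"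
  have x: "0 < ?x" using assms A_pos c_pos by simp
  have "((\<lambda>\<theta>. c\<^sup>2 * \<theta> / A) has_real_derivative c\<^sup>2 / A) (at \<theta>)"
    using A_pos by (auto intro!: derivative_eq_intros)
  with has_real_derivative_powr[OF x, of ?a]
  have "(dens has_real_derivative ?a * ?x powr (?a - 1) * (c\<^sup>2 / A)) (at \<theta>)"
    unfolding dens_def[abs_def] by (rule DERIV_chain2)
  moreover have "?x powr (?a - 1) = dens \<theta> / ?x"
    using x by (metis dens_def powr_diff powr_one order_less_imp_le)
  then have "?a * ?x powr (?a - 1) * (c\<^sup>2 / A) = dens \<theta> / ((\<gamma> - 1) * \<theta>)"
    using assms A_pos c_pos by simp
  ultimately show ?thesis by simp
qed

lemma press_deriv: "0 < \<theta> \<Longrightarrow> (press has_real_derivative c\<^sup>2 * dens \<theta> * stiff \<theta> / (\<gamma> - 1)) (at \<theta>)"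
  unfolding press_def[abs_def]
  by (rule derivative_eq_intros dens_deriv \<Omega>_deriv refl | assumption
      | use gamma in \<open>simp add: stiff_def field_simps power2_eq_square\<close>)+

text \<open>For \<open>0 < \<theta>\<close> the derivative of \<open>press\<close> is computed
  twice, by the product rule and through P by the chain rule. Comparison transfers the sign of
  dP/d\<rho>; at 0 the value is \<gamma>.\<close>

lemma stiff_pos: "0 \<le> \<theta> \<Longrightarrow> 0 < stiff \<theta>"
proof (cases "\<theta> = 0")
  case False
  assume "0 \<le> \<theta>"
  with False have \<theta>: "0 < \<theta>" by simp
  obtain D where D: "(P has_real_derivative D) (at (dens \<theta>))" "0 < D"
    using P_deriv[OF dens_pos[OF \<theta>]] by blast
  have "((\<lambda>x. P (dens x)) has_real_derivative D * (dens \<theta> / ((\<gamma> - 1) * \<theta>))) (at \<theta>)"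
    by (rule DERIV_chain2[OF D(1) dens_deriv[OF \<theta>]])
  then have "(press has_real_derivative D * (dens \<theta> / ((\<gamma> - 1) * \<theta>))) (at \<theta>)"
    by (rule has_field_derivative_transform_within_open[of _ _ _ "{0<..}"]) (use \<theta> press_eq in auto)
  then have "c\<^sup>2 * dens \<theta> * stiff \<theta> / (\<gamma> - 1) = D * (dens \<theta> / ((\<gamma> - 1) * \<theta>))"
    by (rule DERIV_unique[OF press_deriv[OF \<theta>]])
  moreover have "0 < D * (dens \<theta> / ((\<gamma> - 1) * \<theta>))"
    using D \<theta> dens_pos[OF \<theta>] gamma by simp
  ultimately have "0 < c\<^sup>2 * dens \<theta> / (\<gamma> - 1) * stiff \<theta>" by simp
  moreover have "0 < c\<^sup>2 * dens \<theta> / (\<gamma> - 1)"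
    using c_pos dens_pos[OF \<theta>] gamma by simp
  ultimately show ?thesis
    by (rule zero_less_mult_pos)
qed (use gamma in \<open>simp add: stiff_def \<Omega>_0\<close>)

lemma decay_pos: "0 \<le> \<theta> \<Longrightarrow> 0 < decay \<theta>"
  unfolding decay_def using stiff_pos[of \<theta>] \<Omega>_pos[of \<theta>] gamma c_pos
  by (intro mult_pos_pos divide_pos_pos add_pos_nonneg mult_nonneg_nonneg) auto

lemma press_deriv_decay:
  assumes "0 < \<theta>"
  shows "c\<^sup>2 * dens \<theta> * stiff \<theta> / (\<gamma> - 1) * decay \<theta> = dens \<theta> + press \<theta> / c\<^sup>2"
proof -
  have "stiff \<theta> \<noteq> 0" using stiff_pos[of \<theta>] assms by simp
  then show ?thesis
    using gamma c_pos by (simp add: decay_def press_def field_simps)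
qed

lemma press_strict_mono: "0 < x \<Longrightarrow> x < y \<Longrightarrow> press x < press y"
proof -
  assume xy: "0 < x" "x < y"
  show ?thesis
  proof (rule DERIV_pos_imp_increasing[OF xy(2)])
    fix z assume "x \<le> z" "z \<le> y"
    then show "\<exists>D. (press has_real_derivative D) (at z) \<and> 0 < D"
      using press_deriv[of z] dens_pos[of z] stiff_pos[of z] c_pos gamma xy
      by (intro exI[of _ "c\<^sup>2 * dens z * stiff z / (\<gamma> - 1)"]) simp
  qed
qed

lemma P_inj: "inj_on P {0<..}"
proof (rule inj_onI)
  fix x y assume xy: "x \<in> {0<..}" "y \<in> {0<..}" and eq: "P x = P y"
  have p: "press (theta_of z) = P z" if "0 < z" for z
    using press_eq[OF theta_of_pos[OF that]] dens_theta_of[OF that] by simp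
  have "press (theta_of x) = press (theta_of y)"
    using p xy eq by simp
  then have "theta_of x = theta_of y"
    using xy by (metis greaterThan_iff less_irrefl linorder_neqE press_strict_mono theta_of_pos)
  then show "x = y"
    using xy by (metis greaterThan_iff dens_theta_of)
qed

lemma density_of_P: "0 < \<rho> \<Longrightarrow> density_of P (P \<rho>) = \<rho>"
  unfolding density_of_def by (rule the_inv_into_f_f[OF P_inj]) simp

lemma density_of_press: "0 < \<theta> \<Longrightarrow> density_of P (press \<theta>) = dens \<theta>"
  using density_of_P dens_pos press_eq by simp

lemma press_in_range: "0 < \<theta> \<Longrightarrow> press \<theta> \<in> P ` {0<..}"
  using dens_pos press_eq by auto

section \<open>The regularised system\<close>

text \<open>The lower cut extends the equation of state by vacuum. The upper cut confines the
  argument to a compact interval; a solution decreasing from \<open>\<theta>c\<close> never exceeds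
  it.\<close>

definition clamp_\<theta> :: "real \<Rightarrow> real" where
  "clamp_\<theta> x = max 0 (min \<theta>c x)"

definition cdens :: "real \<Rightarrow> real" where "cdens x = dens (clamp_\<theta> x)"
definition cpress :: "real \<Rightarrow> real" where "cpress x = press (clamp_\<theta> x)"
definition cdecay :: "real \<Rightarrow> real" where "cdecay x = decay (clamp_\<theta> x)"

lemma clamp_\<theta>_bounds: "0 \<le> clamp_\<theta> x" "clamp_\<theta> x \<le> \<theta>c"
  using \<theta>c_pos by (auto simp: clamp_\<theta>_def)

lemma clamp_\<theta>_id: "0 \<le> x \<Longrightarrow> x \<le> \<theta>c \<Longrightarrow> clamp_\<theta> x = x"
  by (auto simp: clamp_\<theta>_def)

lemma clamp_\<theta>_lipschitz: "\<bar>clamp_\<theta> x - clamp_\<theta> y\<bar> \<le> \<bar>x - y\<bar>"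
  by (auto simp: clamp_\<theta>_def max_def min_def)

lemma clamped_lipschitz_bound:
  assumes f: "L-lipschitz_on {0..\<theta>c} f"
  obtains K where "0 < K" "\<And>x y. \<bar>f (clamp_\<theta> x) - f (clamp_\<theta> y)\<bar> \<le> K * \<bar>x - y\<bar>"
    "\<And>x. \<bar>f (clamp_\<theta> x)\<bar> \<le> K"
proof -
  obtain B where B: "\<And>x. 0 \<le> x \<Longrightarrow> x \<le> \<theta>c \<Longrightarrow> \<bar>f x\<bar> \<le> B"
    by (rule continuous_on_interval_bounded[OF lipschitz_on_continuous_on[OF f]]) blast
  have L0: "0 \<le> L" by (rule lipschitz_on_nonneg[OF f])
  have B0: "0 \<le> B" using B[of 0] \<theta>c_pos by auto
  have "\<bar>f (clamp_\<theta> x) - f (clamp_\<theta> y)\<bar> \<le> (L + B + 1) * \<bar>x - y\<bar>" for x y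
  proof -
    have "\<bar>f (clamp_\<theta> x) - f (clamp_\<theta> y)\<bar> \<le> L * \<bar>clamp_\<theta> x - clamp_\<theta> y\<bar>"
      using lipschitz_onD[OF f] clamp_\<theta>_bounds by (auto simp: dist_real_def)
    also have "\<dots> \<le> (L + B + 1) * \<bar>x - y\<bar>"
      using clamp_\<theta>_lipschitz L0 B0 by (intro mult_mono) auto
    finally show ?thesis .
  qed
  moreover have "\<bar>f (clamp_\<theta> x)\<bar> \<le> L + B + 1" for x
    using B[of "clamp_\<theta> x"] clamp_\<theta>_bounds L0 by fastforce
  ultimately show ?thesis
    using that[of "L + B + 1"] L0 B0 by auto
qed

lemma dens_lipschitz: obtains K where "K-lipschitz_on {0..\<theta>c} dens"
proof -
  let ?a = "1 / (\<gamma> - 1)"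
  \<comment> \<open>Here \<open>\<gamma> < 2\<close> enters: the density is a power of
    \<open>\<theta>\<close> with exponent at least 1.\<close>
  have a: "1 \<le> ?a" using gamma by simp
  have "((?a * (c\<^sup>2 * \<theta>c / A) powr (?a - 1)) * (c\<^sup>2 / A))-lipschitz_on {0..\<theta>c} (\<lambda>\<theta>. (c\<^sup>2 * \<theta> / A) powr ?a)"
  proof (rule lipschitz_on_compose2[of _ _ "\<lambda>\<theta>. c\<^sup>2 * \<theta> / A" _ "\<lambda>x. x powr ?a"])
    show "(c\<^sup>2 / A)-lipschitz_on {0..\<theta>c} (\<lambda>\<theta>. c\<^sup>2 * \<theta> / A)"
      using A_pos by (intro lipschitz_onI)
        (auto simp: dist_real_def abs_mult simp flip: diff_divide_distrib right_diff_distrib)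
    show "(?a * (c\<^sup>2 * \<theta>c / A) powr (?a - 1))-lipschitz_on ((\<lambda>\<theta>. c\<^sup>2 * \<theta> / A) ` {0..\<theta>c}) (\<lambda>x. x powr ?a)"
      by (rule lipschitz_on_subset[OF powr_lipschitz_on[OF a]])
        (use A_pos in \<open>auto intro!: divide_right_mono mult_left_mono\<close>)
  qed
  then show ?thesis
    using that unfolding dens_def[abs_def] by blast
qed

text \<open>The factor \<open>dens\<close> is handled by its own Lipschitz bound, because its
  derivative formula holds only for positive \<open>\<theta>\<close>; the rest is continuously
  differentiable up to 0.\<close>

lemma press_lipschitz: obtains K where "K-lipschitz_on {0..\<theta>c} press"
proof -
  obtain K1 where K1: "K1-lipschitz_on {0..\<theta>c} dens"
    by (rule dens_lipschitz)
  obtain K2 where K2: "K2-lipschitz_on {0..\<theta>c} (\<lambda>\<theta>. c\<^sup>2 * \<theta> * \<Omega> \<theta>)"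
  proof (rule C1_imp_lipschitz_on_interval)
    show "((\<lambda>\<theta>. c\<^sup>2 * \<theta> * \<Omega> \<theta>) has_real_derivative c\<^sup>2 * (\<Omega> x + x * deriv \<Omega> x)) (at x within {0..\<theta>c})"
      if "0 \<le> x" "x \<le> \<theta>c" for x
      by (rule derivative_eq_intros has_field_derivative_at_within[OF \<Omega>_deriv[OF that(1)]] refl
          | simp add: algebra_simps)+
    show "continuous_on {0..\<theta>c} (\<lambda>x. c\<^sup>2 * (\<Omega> x + x * deriv \<Omega> x))"
      by (intro continuous_intros continuous_on_subset[OF \<Omega>_cont(1)] continuous_on_subset[OF \<Omega>_cont(2)]) auto
  qed
  obtain K where "K-lipschitz_on {0..\<theta>c} (\<lambda>\<theta>. c\<^sup>2 * \<theta> * \<Omega> \<theta> * dens \<theta>)"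
    by (rule lipschitz_on_interval_mult[OF K2 K1])
  then show ?thesis
    using that unfolding press_def[abs_def] by (simp add: mult_ac)
qed

lemma decay_lipschitz: obtains K where "K-lipschitz_on {0..\<theta>c} decay"
proof -
  \<comment> \<open>The derivatives of \<open>stiff\<close> and, by the quotient rule, of
    \<open>decay\<close>.\<close>
  let ?s' = "\<lambda>x. (2 * \<gamma> - 1) * deriv \<Omega> x + (\<gamma> - 1) * x * deriv (deriv \<Omega>) x"
  let ?d = "\<lambda>x. (\<gamma> - 1) / c\<^sup>2 * (((\<Omega> x + x * deriv \<Omega> x) * stiff x - (1 + x * \<Omega> x) * ?s' x) / (stiff x)\<^sup>2)"
  have stiff: "(stiff has_real_derivative ?s' x) (at x)" if "0 \<le> x" for x
    unfolding stiff_def[abs_def]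
    by (rule derivative_eq_intros \<Omega>_deriv[OF that] \<Omega>_deriv2[OF that] refl | simp add: algebra_simps)+
  have cs: "continuous_on {0..} stiff"
    unfolding stiff_def[abs_def] by (intro continuous_intros \<Omega>_cont)
  show ?thesis
  proof (rule C1_imp_lipschitz_on_interval)
    fix x assume x: "0 \<le> x" "x \<le> \<theta>c"
    have sx: "stiff x \<noteq> 0" using stiff_pos[OF x(1)] by simp
    have "(decay has_real_derivative ?d x) (at x)"
      unfolding decay_def[abs_def]
      by (rule derivative_eq_intros \<Omega>_deriv[OF x(1)] stiff[OF x(1)] refl sx
          | simp add: power2_eq_square algebra_simps)+
    then show "(decay has_real_derivative ?d x) (at x within {0..\<theta>c})"
      by (rule has_field_derivative_at_within)
  next
    have "stiff x \<noteq> 0" if "0 \<le> x" for x using stiff_pos[OF that] by simp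
    then show "continuous_on {0..\<theta>c} ?d"
      by (intro continuous_intros continuous_on_subset[OF \<Omega>_cont(1)] continuous_on_subset[OF \<Omega>_cont(2)]
          continuous_on_subset[OF \<Omega>_cont(3)] continuous_on_subset[OF cs]) auto
  qed (rule that)
qed

lemma clamped_bounds:
  obtains K where "0 < K"
    "\<And>x y. \<bar>cdens x - cdens y\<bar> \<le> K * \<bar>x - y\<bar>" "\<And>x. \<bar>cdens x\<bar> \<le> K"
    "\<And>x y. \<bar>cpress x - cpress y\<bar> \<le> K * \<bar>x - y\<bar>" "\<And>x. \<bar>cpress x\<bar> \<le> K"
    "\<And>x y. \<bar>cdecay x - cdecay y\<bar> \<le> K * \<bar>x - y\<bar>" "\<And>x. \<bar>cdecay x\<bar> \<le> K"
proof -
  obtain K1 where "K1-lipschitz_on {0..\<theta>c} dens" by (rule dens_lipschitz)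
  then obtain L1 where L1: "0 < L1" "\<And>x y. \<bar>cdens x - cdens y\<bar> \<le> L1 * \<bar>x - y\<bar>" "\<And>x. \<bar>cdens x\<bar> \<le> L1"
    unfolding cdens_def by (rule clamped_lipschitz_bound) blast
  obtain K2 where "K2-lipschitz_on {0..\<theta>c} press" by (rule press_lipschitz)
  then obtain L2 where L2: "0 < L2" "\<And>x y. \<bar>cpress x - cpress y\<bar> \<le> L2 * \<bar>x - y\<bar>" "\<And>x. \<bar>cpress x\<bar> \<le> L2"
    unfolding cpress_def by (rule clamped_lipschitz_bound) blast
  obtain K3 where "K3-lipschitz_on {0..\<theta>c} decay" by (rule decay_lipschitz)
  then obtain L3 where L3: "0 < L3" "\<And>x y. \<bar>cdecay x - cdecay y\<bar> \<le> L3 * \<bar>x - y\<bar>" "\<And>x. \<bar>cdecay x\<bar> \<le> L3"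
    unfolding cdecay_def by (rule clamped_lipschitz_bound) blast
  let ?K = "L1 + L2 + L3"
  have up: "a \<le> ?K * b" if "a \<le> L * b" "L \<le> ?K" "0 \<le> b" for a b L
    using that mult_right_mono by (meson order_trans)
  show ?thesis
  proof
    show "0 < ?K" using L1(1) L2(1) L3(1) by simp
    fix x y
    show "\<bar>cdens x - cdens y\<bar> \<le> ?K * \<bar>x - y\<bar>" "\<bar>cpress x - cpress y\<bar> \<le> ?K * \<bar>x - y\<bar>"
      "\<bar>cdecay x - cdecay y\<bar> \<le> ?K * \<bar>x - y\<bar>"
      by (rule up[OF L1(2)] up[OF L2(2)] up[OF L3(2)]; use L1(1) L2(1) L3(1) in simp)+
    show "\<bar>cdens x\<bar> \<le> ?K" "\<bar>cpress x\<bar> \<le> ?K" "\<bar>cdecay x\<bar> \<le> ?K"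
      using L1(1) L2(1) L3(1) L1(3)[of x] L2(3)[of x] L3(3)[of x] by linarith+
  qed
qed

lemma continuous_on_clamped: "continuous_on X cdens" "continuous_on X cpress" "continuous_on X cdecay"
proof -
  obtain K where K: "0 < K" "\<And>x y. \<bar>cdens x - cdens y\<bar> \<le> K * \<bar>x - y\<bar>"
    "\<And>x y. \<bar>cpress x - cpress y\<bar> \<le> K * \<bar>x - y\<bar>" "\<And>x y. \<bar>cdecay x - cdecay y\<bar> \<le> K * \<bar>x - y\<bar>"
    by (rule clamped_bounds) blast
  have "K-lipschitz_on X cdens" "K-lipschitz_on X cpress" "K-lipschitz_on X cdecay"
    using K by (auto intro!: lipschitz_onI simp: dist_real_def)
  then show "continuous_on X cdens" "continuous_on X cpress" "continuous_on X cdecay"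
    by (auto intro: lipschitz_on_continuous_on)
qed

lemma cdens_nonneg: "0 \<le> cdens x" and cdecay_pos: "0 < cdecay x" and cpress_nonneg: "0 \<le> cpress x"
proof -
  show "0 \<le> cdens x" "0 < cdecay x"
    using dens_nonneg decay_pos clamp_\<theta>_bounds by (auto simp: cdens_def cdecay_def)
  show "0 \<le> cpress x"
    unfolding cpress_def press_def
    by (intro mult_nonneg_nonneg clamp_\<theta>_bounds dens_nonneg less_imp_le[OF \<Omega>_pos]) simp
qed

end

section \<open>Estimates for the regularised vector field\<close>

lemma inverse_max_diff_le:
  fixes a b k :: real
  assumes "0 < k"
  shows "\<bar>inverse (max k a) - inverse (max k b)\<bar> \<le> \<bar>a - b\<bar> / k\<^sup>2"
proof -
  let ?a = "max k a" and ?b = "max k b"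
  have pos: "0 < ?a" "0 < ?b" using assms by auto
  have "\<bar>inverse ?a - inverse ?b\<bar> = \<bar>?b - ?a\<bar> / (?a * ?b)"
    using pos by (simp add: inverse_eq_divide diff_frac_eq abs_divide abs_mult)
  also have "\<dots> \<le> \<bar>a - b\<bar> / k\<^sup>2"
    using assms by (intro frac_le) (auto simp: power2_eq_square intro!: mult_mono)
  finally show ?thesis .
qed

text \<open>The mean value theorem raises the order of smallness by one. The factor
  \<open>1 / (n + 1)\<close> that integration would give is dropped, since only orders matter in the
  expansions at the centre.\<close>

lemma abs_diff_le_of_deriv_power_bound:
  fixes f f' :: "real \<Rightarrow> real"
  assumes r: "0 < r" and cont: "continuous_on {0..r} f"
    and der: "\<And>s. 0 < s \<Longrightarrow> s < r \<Longrightarrow> (f has_real_derivative f' s) (at s)"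
    and bd: "\<And>s. 0 < s \<Longrightarrow> s < r \<Longrightarrow> \<bar>f' s\<bar> \<le> C * s ^ n" and C: "0 \<le> C"
  shows "\<bar>f r - f 0\<bar> \<le> C * r ^ Suc n"
proof -
  obtain l z where z: "0 < z" "z < r" "(f has_real_derivative l) (at z)" "f r - f 0 = (r - 0) * l"
    using MVT[OF r cont] der by (metis real_differentiable_def)
  have "l = f' z"
    using z der DERIV_unique by blast
  have "\<bar>f r - f 0\<bar> = r * \<bar>f' z\<bar>"
    using z r \<open>l = f' z\<close> by (simp add: abs_mult)
  also have "\<dots> \<le> r * (C * r ^ n)"
    using bd[of z] z r C power_mono[of z r n]
    by (intro mult_left_mono) (auto intro: order_trans mult_left_mono)
  finally show ?thesis by (simp add: mult_ac)
qed

context star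
begin

definition rmass :: "(real \<Rightarrow> real) \<Rightarrow> real \<Rightarrow> real" where
  "rmass y = scaled_mass (\<lambda>t. cdens (y t))"

definition rkappa :: "real \<Rightarrow> (real \<Rightarrow> real) \<Rightarrow> real \<Rightarrow> real" where
  "rkappa \<Lambda> y s = 1 - 2 * G / c\<^sup>2 * s\<^sup>2 * rmass y s - \<Lambda> / 3 * s\<^sup>2"

definition rforce :: "real \<Rightarrow> (real \<Rightarrow> real) \<Rightarrow> real \<Rightarrow> real" where
  "rforce \<Lambda> y s = G * (rmass y s + 4 * pi / c\<^sup>2 * cpress (y s)) - c\<^sup>2 * \<Lambda> / 3"

text \<open>In the variable \<open>\<theta>\<close> the pressure equation reads d\<theta>/dr = -
  decay * Q / (r^2 \<kappa>). With Q = r^3 * rforce the singular denominator cancels and one factor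
  \<open>s\<close> remains. The cut-off \<open>max k\<close> makes the expression meaningful for
  every continuous \<open>y\<close>.\<close>

definition rhs :: "real \<Rightarrow> real \<Rightarrow> (real \<Rightarrow> real) \<Rightarrow> real \<Rightarrow> real" where
  "rhs k \<Lambda> y s = - (s * (cdecay (y s) * (rforce \<Lambda> y s * inverse (max k (rkappa \<Lambda> y s)))))"

lemma continuous_on_cdens_comp: "continuous_on UNIV y \<Longrightarrow> continuous_on X (\<lambda>t. cdens (y t))"
  and continuous_on_cpress_comp: "continuous_on UNIV y \<Longrightarrow> continuous_on X (\<lambda>t. cpress (y t))"
  and continuous_on_cdecay_comp: "continuous_on UNIV y \<Longrightarrow> continuous_on X (\<lambda>t. cdecay (y t))"
  by (rule continuous_on_compose2[OF continuous_on_clamped(1)[of UNIV]]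
      continuous_on_compose2[OF continuous_on_clamped(2)[of UNIV]]
      continuous_on_compose2[OF continuous_on_clamped(3)[of UNIV]], erule continuous_on_subset, simp_all)+

context
  fixes y :: "real \<Rightarrow> real"
  assumes y: "continuous_on UNIV y"
begin

lemma continuous_on_rmass: "continuous_on X (rmass y)"
  unfolding rmass_def by (intro continuous_on_scaled_mass continuous_on_cdens_comp y)

lemma continuous_on_rkappa: "continuous_on X (rkappa \<Lambda> y)"
  unfolding rkappa_def[abs_def] by (intro continuous_intros continuous_on_rmass)

lemma continuous_on_rforce: "continuous_on X (rforce \<Lambda> y)"
  unfolding rforce_def[abs_def] by (intro continuous_intros continuous_on_rmass continuous_on_cpress_comp y)

lemma continuous_on_rhs_factor:
  assumes "0 < k"
  shows "continuous_on X (\<lambda>s. cdecay (y s) * (rforce \<Lambda> y s * inverse (max k (rkappa \<Lambda> y s))))"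
  by (intro continuous_intros continuous_on_rkappa continuous_on_rforce continuous_on_cdecay_comp y)
    (use assms in \<open>auto simp: max_def\<close>)

lemma continuous_on_rhs: "0 < k \<Longrightarrow> continuous_on X (rhs k \<Lambda> y)"
  unfolding rhs_def[abs_def]
  by (intro continuous_on_minus continuous_on_mult[OF continuous_on_id] continuous_on_rhs_factor)

lemma rmass_pos: "y 0 = \<theta>c \<Longrightarrow> 0 < rmass y s"
  unfolding rmass_def
proof (rule scaled_mass_pos[OF continuous_on_cdens_comp[OF y]])
  show "0 < cdens (y 0)" if "y 0 = \<theta>c"
    using that dens_pos[OF \<theta>c_pos] \<theta>c_pos by (simp add: cdens_def clamp_\<theta>_id)
qed (rule cdens_nonneg)

end

text \<open>One constant, depending on \<open>T\<close> and \<open>k\<close> but not on the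
  cosmological constants, covers both uses: equal constants give the Lipschitz condition of the
  Volterra lemmas, and \<open>E = 0\<close> gives the size of the perturbation.\<close>

lemma rhs_perturbation:
  assumes T: "0 \<le> T" and k: "0 < k"
  obtains L where "0 < L"
    and "\<And>\<Lambda> \<Lambda>' y z s E. \<lbrakk>\<bar>\<Lambda>\<bar> \<le> 1; \<bar>\<Lambda>'\<bar> \<le> 1; continuous_on UNIV y; continuous_on UNIV z; 0 \<le> s; s \<le> T;
      \<And>t. 0 \<le> t \<Longrightarrow> t \<le> s \<Longrightarrow> \<bar>y t - z t\<bar> \<le> E\<rbrakk> \<Longrightarrow>
      \<bar>rhs k \<Lambda> y s - rhs k \<Lambda>' z s\<bar> \<le> L * (E + \<bar>\<Lambda> - \<Lambda>'\<bar>)"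
    and "\<And>\<Lambda> \<Lambda>' y z s E. \<lbrakk>\<bar>\<Lambda>\<bar> \<le> 1; \<bar>\<Lambda>'\<bar> \<le> 1; continuous_on UNIV y; continuous_on UNIV z; 0 \<le> s; s \<le> T;
      \<And>t. 0 \<le> t \<Longrightarrow> t \<le> s \<Longrightarrow> \<bar>y t - z t\<bar> \<le> E\<rbrakk> \<Longrightarrow>
      \<bar>rforce \<Lambda> y s - rforce \<Lambda>' z s\<bar> \<le> L * (E + \<bar>\<Lambda> - \<Lambda>'\<bar>)"
    and "\<And>\<Lambda> \<Lambda>' y z s E. \<lbrakk>\<bar>\<Lambda>\<bar> \<le> 1; \<bar>\<Lambda>'\<bar> \<le> 1; continuous_on UNIV y; continuous_on UNIV z; 0 \<le> s; s \<le> T;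
      \<And>t. 0 \<le> t \<Longrightarrow> t \<le> s \<Longrightarrow> \<bar>y t - z t\<bar> \<le> E\<rbrakk> \<Longrightarrow>
      \<bar>rkappa \<Lambda> y s - rkappa \<Lambda>' z s\<bar> \<le> L * (E + \<bar>\<Lambda> - \<Lambda>'\<bar>)"
proof -
  obtain K where K: "0 < K"
    "\<And>x y. \<bar>cdens x - cdens y\<bar> \<le> K * \<bar>x - y\<bar>" "\<And>x. \<bar>cdens x\<bar> \<le> K"
    "\<And>x y. \<bar>cpress x - cpress y\<bar> \<le> K * \<bar>x - y\<bar>" "\<And>x. \<bar>cpress x\<bar> \<le> K"
    "\<And>x y. \<bar>cdecay x - cdecay y\<bar> \<le> K * \<bar>x - y\<bar>" "\<And>x. \<bar>cdecay x\<bar> \<le> K"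
    by (rule clamped_bounds) blast
  \<comment> \<open>Since \<open>K\<close> is both a bound and a Lipschitz constant, so are
    \<open>M\<close> for \<open>rmass\<close> and \<open>LF\<close> for \<open>rforce\<close>;
    \<open>LK\<close> is a Lipschitz constant of \<open>rkappa\<close>. The long product in
    \<open>L\<close> is the product rule for \<open>rhs\<close>, with the reciprocal bounded by
    \<open>inverse k\<close> and varying at rate \<open>LK / k\<^sup>2\<close>.\<close>
  define M where "M = 4 * pi / 3 * K"
  define LF where "LF = G * (M + 4 * pi / c\<^sup>2 * K) + c\<^sup>2 / 3"
  define LK where "LK = 2 * G / c\<^sup>2 * T\<^sup>2 * M + T\<^sup>2 / 3"
  define L where "L = T * (K * (LF * (LK / k\<^sup>2) + LF * inverse k) + K * (LF * inverse k)) + LF + LK"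
  have M0: "0 < M" using K(1) by (simp add: M_def)
  have LF0: "0 < LF" using M0 K(1) G_pos c_pos by (auto simp: LF_def intro!: add_pos_pos mult_pos_pos)
  have LK0: "0 \<le> LK" using M0 T G_pos by (auto simp: LK_def)
  have "0 \<le> T * (K * (LF * (LK / k\<^sup>2) + LF * inverse k) + K * (LF * inverse k))"
    using LF0 LK0 K(1) T k by (intro mult_nonneg_nonneg add_nonneg_nonneg divide_nonneg_nonneg) auto
  then have L: "T * (K * (LF * (LK / k\<^sup>2) + LF * inverse k) + K * (LF * inverse k)) \<le> L" "LF \<le> L" "LK \<le> L" "0 < L"
    using LF0 LK0 unfolding L_def by linarith+
  have main: "\<bar>rforce \<Lambda> y s - rforce \<Lambda>' z s\<bar> \<le> LF * (E + \<bar>\<Lambda> - \<Lambda>'\<bar>)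
      \<and> \<bar>rkappa \<Lambda> y s - rkappa \<Lambda>' z s\<bar> \<le> LK * (E + \<bar>\<Lambda> - \<Lambda>'\<bar>)
      \<and> \<bar>rhs k \<Lambda> y s - rhs k \<Lambda>' z s\<bar>
        \<le> T * (K * (LF * (LK / k\<^sup>2) + LF * inverse k) + K * (LF * inverse k)) * (E + \<bar>\<Lambda> - \<Lambda>'\<bar>)
      \<and> 0 \<le> E"
    if \<Lambda>: "\<bar>\<Lambda>\<bar> \<le> 1" "\<bar>\<Lambda>'\<bar> \<le> 1" and y: "continuous_on UNIV y" and z: "continuous_on UNIV z"
      and s: "0 \<le> s" "s \<le> T" and E: "\<And>t. 0 \<le> t \<Longrightarrow> t \<le> s \<Longrightarrow> \<bar>y t - z t\<bar> \<le> E"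
    for \<Lambda> \<Lambda>' y z s E
  proof -
    let ?e = "E + \<bar>\<Lambda> - \<Lambda>'\<bar>"
    have E0: "0 \<le> E" using E[of 0] s by auto
    have KE: "K * \<bar>y t - z t\<bar> \<le> K * E" if "0 \<le> t" "t \<le> s" for t
      using E[OF that] K(1) by (intro mult_left_mono) auto
    have "\<bar>rmass y s - rmass z s\<bar> \<le> 4 * pi / 3 * (K * E)"
      unfolding rmass_def
      by (rule scaled_mass_diff_le) (use s KE K(2) in \<open>auto intro!: continuous_on_cdens_comp y z intro: order_trans\<close>)
    then have m: "\<bar>rmass y s - rmass z s\<bar> \<le> M * E" by (simp add: M_def)
    have mb: "\<bar>rmass w s\<bar> \<le> M" if "continuous_on UNIV w" for w
      unfolding rmass_def M_def
      by (rule scaled_mass_abs_le) (use s K(3) that in \<open>auto intro!: continuous_on_cdens_comp\<close>)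
    have p: "\<bar>cpress (y s) - cpress (z s)\<bar> \<le> K * E"
      using K(4)[of "y s" "z s"] KE[of s] s by simp
    have F: "\<bar>rforce \<Lambda> y s - rforce \<Lambda>' z s\<bar> \<le> LF * ?e"
    proof -
      have "rforce \<Lambda> y s - rforce \<Lambda>' z s
          = G * ((rmass y s - rmass z s) + 4 * pi / c\<^sup>2 * (cpress (y s) - cpress (z s))) - c\<^sup>2 / 3 * (\<Lambda> - \<Lambda>')"
        by (simp add: rforce_def algebra_simps diff_divide_distrib)
      also have "\<bar>\<dots>\<bar> \<le> G * (\<bar>rmass y s - rmass z s\<bar> + 4 * pi / c\<^sup>2 * \<bar>cpress (y s) - cpress (z s)\<bar>) + c\<^sup>2 / 3 * \<bar>\<Lambda> - \<Lambda>'\<bar>"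
        using G_pos c_pos
        by (intro order_trans[OF abs_triangle_ineq4] add_mono) (auto simp: abs_mult intro!: order_trans[OF abs_triangle_ineq])
      also have "\<dots> \<le> G * (M * E + 4 * pi / c\<^sup>2 * (K * E)) + c\<^sup>2 / 3 * \<bar>\<Lambda> - \<Lambda>'\<bar>"
        using m p G_pos c_pos by (intro add_mono mult_left_mono) auto
      also have "\<dots> = (G * (M + 4 * pi / c\<^sup>2 * K)) * E + c\<^sup>2 / 3 * \<bar>\<Lambda> - \<Lambda>'\<bar>"
        by (simp add: algebra_simps)
      also have "\<dots> \<le> LF * E + LF * \<bar>\<Lambda> - \<Lambda>'\<bar>"
        unfolding LF_def using G_pos c_pos M0 K(1) E0
        by (intro add_mono mult_right_mono) auto
      finally show ?thesis by (simp add: algebra_simps)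
    qed
    have Fb: "\<bar>rforce \<Lambda>' z s\<bar> \<le> LF" if "\<bar>\<Lambda>'\<bar> \<le> 1" "continuous_on UNIV z" for \<Lambda>' z
    proof -
      have "\<bar>rforce \<Lambda>' z s\<bar> \<le> G * (\<bar>rmass z s\<bar> + 4 * pi / c\<^sup>2 * \<bar>cpress (z s)\<bar>) + c\<^sup>2 / 3 * \<bar>\<Lambda>'\<bar>"
        unfolding rforce_def using G_pos c_pos
        by (intro order_trans[OF abs_triangle_ineq4] add_mono) (auto simp: abs_mult intro!: order_trans[OF abs_triangle_ineq])
      also have "\<dots> \<le> G * (M + 4 * pi / c\<^sup>2 * K) + c\<^sup>2 / 3 * 1"
        using mb[OF that(2)] K(5)[of "z s"] that G_pos c_pos by (intro add_mono mult_left_mono) auto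
      finally show ?thesis by (simp add: LF_def)
    qed
    have Ka: "\<bar>rkappa \<Lambda> y s - rkappa \<Lambda>' z s\<bar> \<le> LK * ?e"
    proof -
      have s2: "s\<^sup>2 \<le> T\<^sup>2" using s by (intro power_mono) auto
      have "rkappa \<Lambda> y s - rkappa \<Lambda>' z s = - (2 * G / c\<^sup>2 * s\<^sup>2 * (rmass y s - rmass z s)) - s\<^sup>2 / 3 * (\<Lambda> - \<Lambda>')"
        by (simp add: rkappa_def algebra_simps diff_divide_distrib)
      also have "\<bar>\<dots>\<bar> \<le> 2 * G / c\<^sup>2 * s\<^sup>2 * \<bar>rmass y s - rmass z s\<bar> + s\<^sup>2 / 3 * \<bar>\<Lambda> - \<Lambda>'\<bar>"
        using G_pos by (intro order_trans[OF abs_triangle_ineq4]) (auto simp: abs_mult)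
      also have "\<dots> \<le> 2 * G / c\<^sup>2 * T\<^sup>2 * (M * E) + T\<^sup>2 / 3 * \<bar>\<Lambda> - \<Lambda>'\<bar>"
        using m G_pos s2 M0 E0 by (intro add_mono mult_mono) auto
      also have "\<dots> \<le> LK * E + LK * \<bar>\<Lambda> - \<Lambda>'\<bar>"
        unfolding mult.assoc[symmetric] LK_def using G_pos M0 E0
        by (intro add_mono mult_right_mono) auto
      finally show ?thesis by (simp add: algebra_simps)
    qed
    let ?I = "\<lambda>\<Lambda> y. inverse (max k (rkappa \<Lambda> y s))"
    have I: "\<bar>?I \<Lambda> y - ?I \<Lambda>' z\<bar> \<le> LK * ?e / k\<^sup>2"
      by (rule order_trans[OF inverse_max_diff_le[OF k]]) (use Ka k in \<open>auto intro: divide_right_mono\<close>)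
    have Ib: "\<bar>?I \<Lambda> y\<bar> \<le> inverse k" for \<Lambda> y
      using k by (auto simp: max_def intro!: le_imp_inverse_le)
    have D: "\<bar>cdecay (y s) - cdecay (z s)\<bar> \<le> K * ?e"
    proof -
      have "\<bar>cdecay (y s) - cdecay (z s)\<bar> \<le> K * E"
        using K(6)[of "y s" "z s"] KE[of s] s by simp
      also have "\<dots> \<le> K * ?e"
        using K(1) by (intro mult_left_mono) auto
      finally show ?thesis .
    qed
    have FI: "\<bar>rforce \<Lambda> y s * ?I \<Lambda> y - rforce \<Lambda>' z s * ?I \<Lambda>' z\<bar> \<le> LF * (LK * ?e / k\<^sup>2) + LF * ?e * inverse k"
      by (rule abs_mult_diff_le[OF Fb Ib F I]) (use \<Lambda> y in auto)
    have FIb: "\<bar>rforce \<Lambda>' z s * ?I \<Lambda>' z\<bar> \<le> LF * inverse k"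
      unfolding abs_mult using Fb[OF \<Lambda>(2) z] Ib[of \<Lambda>' z] LF0 by (intro mult_mono) auto
    have "\<bar>rhs k \<Lambda> y s - rhs k \<Lambda>' z s\<bar>
        = s * \<bar>cdecay (y s) * (rforce \<Lambda> y s * ?I \<Lambda> y) - cdecay (z s) * (rforce \<Lambda>' z s * ?I \<Lambda>' z)\<bar>"
      using s by (simp add: rhs_def abs_mult abs_minus_commute flip: right_diff_distrib)
    also have "\<dots> \<le> T * (K * (LF * (LK * ?e / k\<^sup>2) + LF * ?e * inverse k) + K * ?e * (LF * inverse k))"
      by (intro mult_mono abs_mult_diff_le[OF K(7) FIb D FI]) (use s T in auto)
    also have "\<dots> = T * (K * (LF * (LK / k\<^sup>2) + LF * inverse k) + K * (LF * inverse k)) * ?e"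
      by (simp add: algebra_simps)
    finally show ?thesis using F Ka E0 by blast
  qed
  have up: "a \<le> L * (E + \<bar>d\<bar>)" if "a \<le> L' * (E + \<bar>d\<bar>)" "L' \<le> L" "0 \<le> E" for a L' E d
    using that mult_right_mono[of L' L "E + \<bar>d\<bar>"] by simp
  show ?thesis
    by (rule that[OF L(4)]) (use main up L(1-3) in blast)+
qed

lemma regular_solution_exists:
  assumes "0 \<le> T" "0 < k" "\<bar>\<Lambda>\<bar> \<le> 1"
  obtains y where "continuous_on UNIV y"
    and "\<And>r. 0 \<le> r \<Longrightarrow> r \<le> T \<Longrightarrow> y r = \<theta>c + integral {0..r} (rhs k \<Lambda> y)"
proof -
  obtain L where L: "0 < L"
    and lip: "\<And>\<Lambda> \<Lambda>' y z s E. \<lbrakk>\<bar>\<Lambda>\<bar> \<le> 1; \<bar>\<Lambda>'\<bar> \<le> 1; continuous_on UNIV y; continuous_on UNIV z; 0 \<le> s; s \<le> T;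
      \<And>t. 0 \<le> t \<Longrightarrow> t \<le> s \<Longrightarrow> \<bar>y t - z t\<bar> \<le> E\<rbrakk> \<Longrightarrow>
      \<bar>rhs k \<Lambda> y s - rhs k \<Lambda>' z s\<bar> \<le> L * (E + \<bar>\<Lambda> - \<Lambda>'\<bar>)"
    by (rule rhs_perturbation[OF assms(1,2)]) blast
  show ?thesis
  proof (rule volterra_exists[OF assms(1) L, of "rhs k \<Lambda>" \<theta>c])
    show "continuous_on {0..T} (rhs k \<Lambda> u)" if "continuous_on UNIV u" for u
      by (rule continuous_on_rhs[OF that assms(2)])
    show "\<bar>rhs k \<Lambda> u s - rhs k \<Lambda> v s\<bar> \<le> L * E"
      if "continuous_on UNIV u" "continuous_on UNIV v" "0 \<le> s" "s \<le> T"
        "\<And>t. 0 \<le> t \<Longrightarrow> t \<le> s \<Longrightarrow> \<bar>u t - v t\<bar> \<le> E" for u v s E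
      using lip[OF assms(3) assms(3) that] by simp
  qed (use that in blast)
qed

lemma regular_solution_deriv:
  assumes y: "continuous_on UNIV y" and k: "0 < k"
    and eq: "\<And>r. 0 \<le> r \<Longrightarrow> r \<le> T \<Longrightarrow> y r = \<theta>c + integral {0..r} (rhs k \<Lambda> y)"
    and r: "0 < r" "r < T"
  shows "(y has_real_derivative rhs k \<Lambda> y r) (at r)"
proof -
  have "((\<lambda>r. \<theta>c + integral {0..r} (rhs k \<Lambda> y)) has_real_derivative 0 + rhs k \<Lambda> y r) (at r within {0..T})"
    by (intro DERIV_add DERIV_const integral_has_real_derivative continuous_on_rhs y k) (use r in auto)
  then have "((\<lambda>r. \<theta>c + integral {0..r} (rhs k \<Lambda> y)) has_real_derivative rhs k \<Lambda> y r) (at r)"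
    using r by (simp add: at_within_Icc_at)
  then show ?thesis
    by (rule has_field_derivative_transform_within_open[of _ _ _ "{0<..<T}"]) (use r eq in auto)
qed

section \<open>Regular solutions as solutions of the TOV equation\<close>

text \<open>Wherever neither the clamp of \<open>\<theta>\<close> nor the cut-off of \<open>\<kappa>\<close> at \<open>k\<close> is active, the
  regularised system is the original one.\<close>

lemma rkappa_eq: "0 < r \<Longrightarrow> tov_kappa c G \<Lambda> r (r ^ 3 * rmass y r) = rkappa \<Lambda> y r"
  by (simp add: tov_kappa_def rkappa_def field_simps power2_eq_square power3_eq_cube)

lemma rforce_eq: "tov_Q c G \<Lambda> r (r ^ 3 * rmass y r) (cpress (y r)) = r ^ 3 * rforce \<Lambda> y r"
  by (simp add: tov_Q_def rforce_def field_simps)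

context
  fixes y :: "real \<Rightarrow> real" and k \<Lambda> R :: real
  assumes y: "continuous_on UNIV y" and k: "0 < k" "k \<le> 1"
    and y0: "y 0 = \<theta>c"
    and R: "0 < R"
    and yR: "\<And>r. 0 < r \<Longrightarrow> r < R \<Longrightarrow> 0 < y r \<and> y r < \<theta>c"
    and kR: "\<And>r. 0 < r \<Longrightarrow> r < R \<Longrightarrow> k < rkappa \<Lambda> y r"
    and der: "\<And>r. 0 < r \<Longrightarrow> r < R \<Longrightarrow> (y has_real_derivative rhs k \<Lambda> y r) (at r)"
begin

lemma clamped_inactive:
  assumes "0 < r" "r < R"
  shows "cdens (y r) = dens (y r)" "cpress (y r) = press (y r)" "cdecay (y r) = decay (y r)"
  using yR[OF assms] by (simp_all add: cdens_def cpress_def cdecay_def clamp_\<theta>_id)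

text \<open>By \<open>press_deriv_decay\<close> the product of the derivative of
  \<open>press\<close> with \<open>decay\<close> recombines to \<rho> + P/c^2. The cut-off is kept
  in the formula, so that continuity and bounds of \<open>rhs\<close> type carry over to the
  expansion at the centre.\<close>

lemma regular_pressure_deriv:
  assumes r: "0 < r" "r < R"
  shows "((\<lambda>r. cpress (y r)) has_real_derivative
      - (r * ((cdens (y r) + cpress (y r) / c\<^sup>2) * (rforce \<Lambda> y r * inverse (max k (rkappa \<Lambda> y r)))))) (at r)"
proof -
  let ?f = "rforce \<Lambda> y r * inverse (max k (rkappa \<Lambda> y r))"
  have yr: "0 < y r" using yR[OF r] by simp
  have "((\<lambda>r. press (y r)) has_real_derivative c\<^sup>2 * dens (y r) * stiff (y r) / (\<gamma> - 1) * rhs k \<Lambda> y r) (at r)"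
    by (rule DERIV_chain2[OF press_deriv[OF yr] der[OF r]])
  then have "((\<lambda>r. cpress (y r)) has_real_derivative c\<^sup>2 * dens (y r) * stiff (y r) / (\<gamma> - 1) * rhs k \<Lambda> y r) (at r)"
    by (rule has_field_derivative_transform_within_open[of _ _ _ "{0<..<R}"])
      (use r clamped_inactive in auto)
  moreover have "c\<^sup>2 * dens (y r) * stiff (y r) / (\<gamma> - 1) * rhs k \<Lambda> y r
      = - (r * ((c\<^sup>2 * dens (y r) * stiff (y r) / (\<gamma> - 1) * decay (y r)) * ?f))"
    by (simp add: rhs_def clamped_inactive[OF r])
  ultimately show ?thesis
    unfolding press_deriv_decay[OF yr] by (simp add: clamped_inactive[OF r])
qed

lemma regular_tov_solution:
  "tov_solution c G \<Lambda> P (ereal R) (\<lambda>r. r ^ 3 * rmass y r) (\<lambda>r. cpress (y r))"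
  unfolding tov_solution_def
proof (intro conjI allI impI)
  show "0 < ereal R" using R by simp
  fix r assume "0 < r \<and> ereal r < ereal R"
  then have r: "0 < r" "r < R" by auto
  note [simp] = clamped_inactive[OF r]
  have yr: "0 < y r" using yR[OF r] by simp
  have kr: "max k (rkappa \<Lambda> y r) = rkappa \<Lambda> y r" "0 < rkappa \<Lambda> y r"
    using kR[OF r] k(1) by auto
  show "(r, r ^ 3 * rmass y r, cpress (y r)) \<in> tov_domain c G \<Lambda> P"
    using r kr press_in_range[OF yr] by (simp add: tov_domain_def rkappa_eq)
  show "((\<lambda>r. r ^ 3 * rmass y r) has_real_derivative 4 * pi * r\<^sup>2 * density_of P (cpress (y r))) (at r)"
    using has_real_derivative_scaled_mass[OF continuous_on_cdens_comp[OF y] r(1)] density_of_press[OF yr]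
    by (simp add: rmass_def)
  have d: "density_of P (cpress (y r)) = cdens (y r)"
    using density_of_press[OF yr] by simp
  have alg: "- (r * (D * (F * inverse K))) = - D * (r ^ 3 * F / (r\<^sup>2 * K))" if "K \<noteq> 0" for D F K
    using r that by (simp add: field_simps power2_eq_square power3_eq_cube)
  have "- (r * ((cdens (y r) + cpress (y r) / c\<^sup>2) * (rforce \<Lambda> y r * inverse (rkappa \<Lambda> y r))))
      = - (cdens (y r) + cpress (y r) / c\<^sup>2) * (r ^ 3 * rforce \<Lambda> y r / (r\<^sup>2 * rkappa \<Lambda> y r))"
    by (rule alg) (use kr(2) in simp)
  from DERIV_cong[OF regular_pressure_deriv[OF r, unfolded kr(1)] this]
  show "((\<lambda>r. cpress (y r)) has_real_derivative
      - (density_of P (cpress (y r)) + cpress (y r) / c\<^sup>2) *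
        (tov_Q c G \<Lambda> r (r ^ 3 * rmass y r) (cpress (y r)) / (r\<^sup>2 * tov_kappa c G \<Lambda> r (r ^ 3 * rmass y r)))) (at r)"
    unfolding d rkappa_eq[OF r(1)] rforce_eq .
qed

text \<open>The factor \<open>s\<close> in \<open>rhs\<close> makes the derivative of order
  \<open>r\<close>, hence the deviation from \<open>\<theta>c\<close> of order
  \<open>r\<^sup>2\<close>.\<close>

lemma regular_quadratic_bound:
  obtains C where "0 \<le> C" "\<And>r. 0 \<le> r \<Longrightarrow> r < R \<Longrightarrow> \<bar>y r - \<theta>c\<bar> \<le> C * r\<^sup>2"
proof -
  let ?h = "\<lambda>s. cdecay (y s) * (rforce \<Lambda> y s * inverse (max k (rkappa \<Lambda> y s)))"
  obtain C where C: "\<And>s. 0 \<le> s \<Longrightarrow> s \<le> R \<Longrightarrow> \<bar>?h s\<bar> \<le> C"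
    by (rule continuous_on_interval_bounded[OF continuous_on_rhs_factor[OF y k(1)]]) blast
  have C0: "0 \<le> C" using C[of 0] R by auto
  have "\<bar>y r - \<theta>c\<bar> \<le> C * r\<^sup>2" if r: "0 \<le> r" "r < R" for r
  proof (cases "r = 0")
    case False
    then have r0: "0 < r" using r by simp
    have "\<bar>y r - y 0\<bar> \<le> C * r ^ Suc 1"
    proof (rule abs_diff_le_of_deriv_power_bound[OF r0, of y "rhs k \<Lambda> y"])
      show "\<bar>rhs k \<Lambda> y s\<bar> \<le> C * s ^ 1" if "0 < s" "s < r" for s
        using C[of s] that r mult_right_mono[of "\<bar>?h s\<bar>" C s] by (simp add: rhs_def abs_mult mult.commute)
    qed (use der r C0 in \<open>auto intro: continuous_on_subset[OF y]\<close>)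
    then show ?thesis using y0 by (simp add: power2_eq_square)
  qed (simp add: y0)
  with C0 show ?thesis by (rule that)
qed

text \<open>Everything is compared with the constant profile \<open>\<theta>c\<close>. Densities,
  forces and the reciprocal of \<kappa> deviate by order \<open>s\<^sup>2\<close>; the derivatives
  of the two remainders are then of order \<open>s ^ 4\<close> and \<open>s ^ 3\<close>, and one
  application of the mean value theorem gives the orders 5 and 4.\<close>

lemma regular_has_central_density:
  assumes \<Lambda>: "\<bar>\<Lambda>\<bar> \<le> 1"
  shows "has_central_density c G \<Lambda> P \<rho>c (\<lambda>r. r ^ 3 * rmass y r) (\<lambda>r. cpress (y r))"
proof -
  obtain C where C0: "0 \<le> C" and C: "\<And>r. 0 \<le> r \<Longrightarrow> r < R \<Longrightarrow> \<bar>y r - \<theta>c\<bar> \<le> C * r\<^sup>2"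
    by (rule regular_quadratic_bound) blast
  obtain K where K: "0 < K"
    "\<And>x y. \<bar>cdens x - cdens y\<bar> \<le> K * \<bar>x - y\<bar>" "\<And>x. \<bar>cdens x\<bar> \<le> K"
    "\<And>x y. \<bar>cpress x - cpress y\<bar> \<le> K * \<bar>x - y\<bar>" "\<And>x. \<bar>cpress x\<bar> \<le> K"
    by (rule clamped_bounds) blast
  obtain L where L: "0 < L"
    and LF: "\<And>\<Lambda> \<Lambda>' y z s E. \<lbrakk>\<bar>\<Lambda>\<bar> \<le> 1; \<bar>\<Lambda>'\<bar> \<le> 1; continuous_on UNIV y; continuous_on UNIV z; 0 \<le> s; s \<le> R;
      \<And>t. 0 \<le> t \<Longrightarrow> t \<le> s \<Longrightarrow> \<bar>y t - z t\<bar> \<le> E\<rbrakk> \<Longrightarrow>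
      \<bar>rforce \<Lambda> y s - rforce \<Lambda>' z s\<bar> \<le> L * (E + \<bar>\<Lambda> - \<Lambda>'\<bar>)"
    and LK: "\<And>\<Lambda> \<Lambda>' y z s E. \<lbrakk>\<bar>\<Lambda>\<bar> \<le> 1; \<bar>\<Lambda>'\<bar> \<le> 1; continuous_on UNIV y; continuous_on UNIV z; 0 \<le> s; s \<le> R;
      \<And>t. 0 \<le> t \<Longrightarrow> t \<le> s \<Longrightarrow> \<bar>y t - z t\<bar> \<le> E\<rbrakk> \<Longrightarrow>
      \<bar>rkappa \<Lambda> y s - rkappa \<Lambda>' z s\<bar> \<le> L * (E + \<bar>\<Lambda> - \<Lambda>'\<bar>)"
    by (rule rhs_perturbation[of R k]) (use R k in \<open>auto 0 3\<close>)
  have c\<theta>: "cdens \<theta>c = \<rho>c" "cpress \<theta>c = P \<rho>c"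
    using \<theta>c_pos press_eq[OF \<theta>c_pos] dens_\<theta>c by (simp_all add: cdens_def cpress_def clamp_\<theta>_id)
  let ?y0 = "\<lambda>_. \<theta>c" and ?I = "\<lambda>s. inverse (max k (rkappa \<Lambda> y s))"
  let ?D = "\<lambda>s. cdens (y s) + cpress (y s) / c\<^sup>2"
  have rm0: "rmass ?y0 s = 4 * pi / 3 * \<rho>c" for s
  proof -
    have "rmass ?y0 s = rmass ?y0 0" by (simp add: rmass_def scaled_mass_def)
    then show ?thesis by (simp add: rmass_def scaled_mass_at_0 c\<theta>)
  qed
  \<comment> \<open>Central values of \<open>rforce\<close> and of \<rho> + P/c^2. The bracket in
    the prescribed germ is \<open>3 * F0\<close>, which turns its factor 1/6 into 1/2.\<close>
  define F0 where "F0 = G * (4 * pi / 3 * \<rho>c + 4 * pi / c\<^sup>2 * P \<rho>c) - c\<^sup>2 * \<Lambda> / 3"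
  define D0 where "D0 = \<rho>c + P \<rho>c / c\<^sup>2"
  have rF0: "rforce \<Lambda> ?y0 s = F0" for s
    by (simp add: rforce_def rm0 c\<theta> F0_def)
  have E: "\<bar>y t - ?y0 t\<bar> \<le> C * s\<^sup>2" if "0 \<le> t" "t \<le> s" "s < R" for t s
    using C[of t] that mult_left_mono[OF power_mono[of t s 2] C0] by auto
  have dF: "\<bar>rforce \<Lambda> y s - F0\<bar> \<le> L * C * s\<^sup>2" if "0 \<le> s" "s < R" for s
    using LF[OF \<Lambda> \<Lambda> y continuous_on_const[of _ \<theta>c] that(1) _ E] that rF0[of s] by (simp add: mult.assoc)
  \<comment> \<open>The deviation of \<kappa> from 1 along the constant profile is at most
    \<open>KB * s\<^sup>2\<close>; the summand 1 absorbs \<open>\<Lambda> / 3\<close>.\<close>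
  define KB where "KB = 2 * G / c\<^sup>2 * (4 * pi / 3 * \<rho>c) + 1"
  have KB0: "0 \<le> KB" using G_pos \<rho>c_pos by (simp add: KB_def)
  have dK: "\<bar>?I s - 1\<bar> \<le> (L * C + KB) / k\<^sup>2 * s\<^sup>2" if s: "0 \<le> s" "s < R" for s
  proof -
    have "\<bar>rkappa \<Lambda> y s - rkappa \<Lambda> ?y0 s\<bar> \<le> L * C * s\<^sup>2"
      using LK[OF \<Lambda> \<Lambda> y continuous_on_const[of _ \<theta>c] s(1) _ E] s by (simp add: mult.assoc)
    moreover have "\<bar>rkappa \<Lambda> ?y0 s - 1\<bar> \<le> KB * s\<^sup>2"
    proof -
      have "rkappa \<Lambda> ?y0 s - 1 = - ((2 * G / c\<^sup>2 * (4 * pi / 3 * \<rho>c) + \<Lambda> / 3) * s\<^sup>2)"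
        by (simp add: rkappa_def rm0 algebra_simps)
      also have "\<bar>\<dots>\<bar> = \<bar>2 * G / c\<^sup>2 * (4 * pi / 3 * \<rho>c) + \<Lambda> / 3\<bar> * s\<^sup>2"
        by (simp only: abs_minus_cancel abs_mult abs_power2)
      also have "\<dots> \<le> KB * s\<^sup>2"
        using \<Lambda> G_pos \<rho>c_pos unfolding KB_def
        by (intro mult_right_mono order_trans[OF abs_triangle_ineq] add_mono) auto
      finally show ?thesis .
    qed
    ultimately have "\<bar>rkappa \<Lambda> y s - 1\<bar> \<le> (L * C + KB) * s\<^sup>2"
      by (simp add: algebra_simps)
    then have "\<bar>rkappa \<Lambda> y s - 1\<bar> / k\<^sup>2 \<le> (L * C + KB) * s\<^sup>2 / k\<^sup>2"
      by (rule divide_right_mono) simp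
    \<comment> \<open>At the centre \<kappa> is 1, so \<open>k \<le> 1\<close> leaves the central
      value untouched by the cut-off.\<close>
    moreover have "max k 1 = 1" using k by simp
    ultimately show ?thesis
      using inverse_max_diff_le[OF k(1), of "rkappa \<Lambda> y s" 1] by simp
  qed
  define KD where "KD = K + K / c\<^sup>2"
  have KD0: "0 \<le> KD" using K(1) by (simp add: KD_def)
  have CE: "\<bar>cdens (y s) - \<rho>c\<bar> \<le> K * (C * s\<^sup>2)" "\<bar>cpress (y s) - P \<rho>c\<bar> \<le> K * (C * s\<^sup>2)"
    if s: "0 \<le> s" "s < R" for s
  proof -
    have "K * \<bar>y s - \<theta>c\<bar> \<le> K * (C * s\<^sup>2)"
      using C[OF s] K(1) by (intro mult_left_mono) auto
    then show "\<bar>cdens (y s) - \<rho>c\<bar> \<le> K * (C * s\<^sup>2)" "\<bar>cpress (y s) - P \<rho>c\<bar> \<le> K * (C * s\<^sup>2)"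
      using K(2)[of "y s" \<theta>c] K(4)[of "y s" \<theta>c] unfolding c\<theta> by linarith+
  qed
  have dD: "\<bar>?D s - D0\<bar> \<le> KD * C * s\<^sup>2" if s: "0 \<le> s" "s < R" for s
  proof -
    have "?D s - D0 = (cdens (y s) - \<rho>c) + (cpress (y s) - P \<rho>c) / c\<^sup>2"
      by (simp add: D0_def diff_divide_distrib)
    also have "\<bar>\<dots>\<bar> \<le> K * (C * s\<^sup>2) + K * (C * s\<^sup>2) / c\<^sup>2"
      using CE[OF s] by (intro order_trans[OF abs_triangle_ineq] add_mono) (auto simp: abs_divide intro: divide_right_mono)
    finally show ?thesis by (simp add: KD_def algebra_simps)
  qed
  have Db: "\<bar>?D s\<bar> \<le> KD" for s
    using K(3)[of "y s"] K(5)[of "y s"] unfolding KD_def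
    by (intro order_trans[OF abs_triangle_ineq] add_mono) (auto simp: abs_divide intro: divide_right_mono)
  define KI where "KI = (L * C + KB) / k\<^sup>2"
  have KI0: "0 \<le> KI" using L C0 KB0 by (simp add: KI_def)
  define N where "N = KD * (\<bar>F0\<bar> * KI + L * C * inverse k) + KD * C * \<bar>F0\<bar>"
  have N0: "0 \<le> N"
    unfolding N_def using KD0 KI0 L C0 k by (intro add_nonneg_nonneg mult_nonneg_nonneg) auto
  have dN: "\<bar>?D s * (rforce \<Lambda> y s * ?I s) - D0 * F0\<bar> \<le> N * s\<^sup>2" if s: "0 \<le> s" "s < R" for s
  proof -
    have Ib: "\<bar>?I s\<bar> \<le> inverse k"
      using k by (auto simp: max_def intro!: le_imp_inverse_le)
    have "\<bar>F0 * 1 - rforce \<Lambda> y s * ?I s\<bar> \<le> \<bar>F0\<bar> * (KI * s\<^sup>2) + L * C * s\<^sup>2 * inverse k"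
      by (rule abs_mult_diff_le[OF order_refl Ib]) (use dF[OF s] dK[OF s] in \<open>auto simp: KI_def abs_minus_commute\<close>)
    then have "\<bar>rforce \<Lambda> y s * ?I s - F0\<bar> \<le> (\<bar>F0\<bar> * KI + L * C * inverse k) * s\<^sup>2"
      by (simp add: abs_minus_commute algebra_simps)
    from abs_mult_diff_le[OF Db order_refl dD[OF s] this]
    show ?thesis by (simp add: N_def algebra_simps)
  qed
  have m: "\<bar>r ^ 3 * rmass y r - 4 * pi / 3 * \<rho>c * r ^ 3\<bar> \<le> 4 * pi * K * C * r ^ 5" if r: "0 < r" "r < R" for r
  proof -
    have "\<bar>(r ^ 3 * rmass y r - 4 * pi / 3 * \<rho>c * r ^ 3) - (0 ^ 3 * rmass y 0 - 4 * pi / 3 * \<rho>c * 0 ^ 3)\<bar>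
        \<le> 4 * pi * K * C * r ^ Suc 4"
    proof (rule abs_diff_le_of_deriv_power_bound[OF r(1)])
      show "continuous_on {0..r} (\<lambda>r. r ^ 3 * rmass y r - 4 * pi / 3 * \<rho>c * r ^ 3)"
        by (intro continuous_intros continuous_on_rmass y)
      fix s assume s: "0 < s" "s < r"
      have "((\<lambda>r. 4 * pi / 3 * \<rho>c * r ^ 3) has_real_derivative 4 * pi * s\<^sup>2 * \<rho>c) (at s)"
        by (auto intro!: derivative_eq_intros)
      then show "((\<lambda>r. r ^ 3 * rmass y r - 4 * pi / 3 * \<rho>c * r ^ 3) has_real_derivative
          4 * pi * s\<^sup>2 * cdens (y s) - 4 * pi * s\<^sup>2 * \<rho>c) (at s)"
        unfolding rmass_def
        by (intro DERIV_diff has_real_derivative_scaled_mass[OF continuous_on_cdens_comp[OF y] s(1)])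
      have "\<bar>cdens (y s) - \<rho>c\<bar> \<le> K * (C * s\<^sup>2)"
        using CE(1)[of s] s r by simp
      then have "4 * pi * s\<^sup>2 * \<bar>cdens (y s) - \<rho>c\<bar> \<le> 4 * pi * s\<^sup>2 * (K * (C * s\<^sup>2))"
        by (intro mult_left_mono) auto
      also have "\<dots> = 4 * pi * K * C * s ^ 4"
        by (simp add: power2_eq_square power4_eq_xxxx)
      also have "4 * pi * s\<^sup>2 * \<bar>cdens (y s) - \<rho>c\<bar> = \<bar>4 * pi * s\<^sup>2 * (cdens (y s) - \<rho>c)\<bar>"
        by (simp add: abs_mult)
      finally show "\<bar>4 * pi * s\<^sup>2 * cdens (y s) - 4 * pi * s\<^sup>2 * \<rho>c\<bar> \<le> 4 * pi * K * C * s ^ 4"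
        by (simp only: right_diff_distrib)
    qed (use K(1) C0 in auto)
    then show ?thesis by simp
  qed
  have p: "\<bar>cpress (y r) - (P \<rho>c - D0 * F0 * (r\<^sup>2 / 2))\<bar> \<le> N * r ^ 4" if r: "0 < r" "r < R" for r
  proof -
    have "\<bar>(cpress (y r) + D0 * F0 * (r\<^sup>2 / 2)) - (cpress (y 0) + D0 * F0 * (0\<^sup>2 / 2))\<bar> \<le> N * r ^ Suc 3"
    proof (rule abs_diff_le_of_deriv_power_bound[OF r(1)])
      show "continuous_on {0..r} (\<lambda>r. cpress (y r) + D0 * F0 * (r\<^sup>2 / 2))"
        by (intro continuous_intros continuous_on_cpress_comp y) auto
      fix s assume s: "0 < s" "s < r"
      then have sR: "s < R" using r by simp
      have "((\<lambda>r. D0 * F0 * (r\<^sup>2 / 2)) has_real_derivative s * (D0 * F0)) (at s)"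
        by (auto intro!: derivative_eq_intros)
      then show "((\<lambda>r. cpress (y r) + D0 * F0 * (r\<^sup>2 / 2)) has_real_derivative
          - (s * (?D s * (rforce \<Lambda> y s * ?I s))) + s * (D0 * F0)) (at s)"
        by (intro DERIV_add regular_pressure_deriv s(1) sR)
      have "\<bar>- (s * (?D s * (rforce \<Lambda> y s * ?I s))) + s * (D0 * F0)\<bar>
          = s * \<bar>?D s * (rforce \<Lambda> y s * ?I s) - D0 * F0\<bar>"
        using s by (simp add: abs_mult abs_minus_commute flip: right_diff_distrib)
      also have "\<dots> \<le> s * (N * s\<^sup>2)"
        using dN[of s] s sR by (intro mult_left_mono) auto
      finally show "\<bar>- (s * (?D s * (rforce \<Lambda> y s * ?I s))) + s * (D0 * F0)\<bar> \<le> N * s ^ 3"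
        by (simp add: power2_eq_square power3_eq_cube mult_ac)
    qed (rule N0)
    then show ?thesis by (simp add: y0 c\<theta> algebra_simps)
  qed
  have DF: "D0 * F0 * (r\<^sup>2 / 2) = (\<rho>c + P \<rho>c / c\<^sup>2)
      * (4 * pi * G * (\<rho>c + 3 * P \<rho>c / c\<^sup>2) - c\<^sup>2 * \<Lambda>) * (r\<^sup>2 / 6)" for r
  proof -
    have "3 * F0 = 4 * pi * G * (\<rho>c + 3 * P \<rho>c / c\<^sup>2) - c\<^sup>2 * \<Lambda>"
      by (simp add: F0_def algebra_simps)
    moreover have "D0 * F0 * (r\<^sup>2 / 2) = D0 * (3 * F0) * (r\<^sup>2 / 6)" by simp
    ultimately show ?thesis unfolding D0_def by simp
  qed
  have ev: "eventually (\<lambda>r. 0 < r \<and> r < R) (at_right (0::real))"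
    using R by (auto simp: eventually_at_right_field)
  show ?thesis
    unfolding has_central_density_def DF[symmetric]
  proof
    show "(\<lambda>r. r ^ 3 * rmass y r - 4 * pi / 3 * \<rho>c * r ^ 3) \<in> O[at_right 0](\<lambda>r. r ^ 5)"
      by (rule bigoI[of _ "4 * pi * K * C"], rule eventually_mono[OF ev]) (use m in auto)
    show "(\<lambda>r. cpress (y r) - (P \<rho>c - D0 * F0 * (r\<^sup>2 / 2))) \<in> O[at_right 0](\<lambda>r. r ^ 4)"
      by (rule bigoI[of _ N], rule eventually_mono[OF ev]) (use p in auto)
  qed
qed

end

end

section \<open>One-sided limits and mean values at the centre\<close>

lemma bigo_power_tendsto_0:
  fixes f :: "real \<Rightarrow> real"
  assumes "f \<in> O[at_right 0](\<lambda>r. r ^ Suc n)"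
  shows "(f \<longlongrightarrow> 0) (at_right 0)"
proof -
  obtain C where C: "eventually (\<lambda>r. norm (f r) \<le> C * norm (r ^ Suc n)) (at_right 0)"
    using assms by (rule landau_o.bigE)
  have "((\<lambda>r::real. C * norm (r ^ Suc n)) \<longlongrightarrow> C * norm ((0::real) ^ Suc n)) (at_right 0)"
    by (intro tendsto_intros)
  then show ?thesis
    using Lim_null_comparison[OF C] by simp
qed

lemma continuous_on_UNIV_tendsto_at_left:
  fixes f :: "real \<Rightarrow> real"
  assumes "continuous_on UNIV f"
  shows "(f \<longlongrightarrow> f a) (at_left a)"
  using assms by (simp add: continuous_on_def filterlim_at_split)

text \<open>A germ is given only for positive radii. Replacing the value at 0 by the limit makes the
  ordinary mean value theorem applicable.\<close>

lemma MVT_right_limit: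
  fixes f f' :: "real \<Rightarrow> real"
  assumes r: "0 < r" and lim: "(f \<longlongrightarrow> l) (at_right 0)"
    and der: "\<And>s. 0 < s \<Longrightarrow> s \<le> r \<Longrightarrow> (f has_real_derivative f' s) (at s)"
  obtains z where "0 < z" "z < r" "f r - l = r * f' z"
proof -
  let ?F = "\<lambda>s. if s = 0 then l else f s"
  have d: "(?F has_real_derivative f' s) (at s)" if "0 < s" "s \<le> r" for s
    by (rule has_field_derivative_transform_within_open[OF der[OF that], of "{0<..}"]) (use that in auto)
  have c: "continuous_on {0..r} ?F"
    unfolding continuous_on_eq_continuous_within
  proof
    fix x assume x: "x \<in> {0..r}"
    show "continuous (at x within {0..r}) ?F"
    proof (cases "x = 0")
      case True
      have "(?F \<longlongrightarrow> l) (at_right 0)"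
        by (rule Lim_transform_eventually[OF lim]) (auto simp: eventually_at_filter)
      then show ?thesis
        using True r by (simp add: continuous_within at_within_Icc_at_right)
    next
      case False
      then show ?thesis
        using d[of x] x by (auto intro: continuous_at_imp_continuous_at_within DERIV_isCont)
    qed
  qed
  have "\<And>x. 0 < x \<Longrightarrow> x < r \<Longrightarrow> ?F differentiable (at x)"
    unfolding real_differentiable_def using d by (meson less_imp_le)
  from MVT[OF r c this]
  obtain L z where z: "0 < z" "z < r" "(?F has_real_derivative L) (at z)" "?F r - ?F 0 = (r - 0) * L"
    by blast
  have "L = f' z"
    using DERIV_unique[OF z(3) d] z by simp
  then show ?thesis
    using that[of z] z r by simp
qed

context star
begin

section \<open>The short star for \<open>\<Lambda> = 0\<close>\<close>

definition theta_of_press :: "real \<Rightarrow> real" where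
  "theta_of_press x = theta_of (density_of P x)"

lemma theta_of_press_press: "0 < \<theta> \<Longrightarrow> theta_of_press (press \<theta>) = \<theta>"
  by (simp add: theta_of_press_def density_of_press theta_of_dens)

lemma press_theta_of_press:
  assumes "x \<in> P ` {0<..}"
  shows "0 < theta_of_press x" "press (theta_of_press x) = x"
    "dens (theta_of_press x) = density_of P x"
proof -
  obtain \<rho> where \<rho>: "0 < \<rho>" "x = P \<rho>" using assms by auto
  then have *: "theta_of_press x = theta_of \<rho>" "density_of P x = \<rho>"
    by (simp_all add: theta_of_press_def density_of_P)
  show "0 < theta_of_press x" "dens (theta_of_press x) = density_of P x"
    using \<rho> * theta_of_pos dens_theta_of by simp_all
  show "press (theta_of_press x) = x"
    using \<rho> * theta_of_pos press_eq dens_theta_of by simp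
qed

text \<open>\<open>density_of P\<close> is a mere set-theoretic inverse. Its regularity comes from
  the inverse function theorem for \<open>press\<close>, whose derivative does not vanish at
  positive \<open>\<theta>\<close>.\<close>

lemma theta_of_press_deriv:
  assumes "0 < \<theta>"
  shows "(theta_of_press has_real_derivative inverse (c\<^sup>2 * dens \<theta> * stiff \<theta> / (\<gamma> - 1))) (at (press \<theta>))"
  unfolding has_field_derivative_def
proof (rule has_derivative_inverse_strong[of "{0<..}" \<theta> press theta_of_press "(*) (c\<^sup>2 * dens \<theta> * stiff \<theta> / (\<gamma> - 1))"])
  let ?d = "c\<^sup>2 * dens \<theta> * stiff \<theta> / (\<gamma> - 1)"
  show "(press has_derivative (*) ?d) (at \<theta>)"
    using press_deriv[OF assms] by (simp add: has_field_derivative_def)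
  have "c\<^sup>2 * dens \<theta> * stiff \<theta> / (\<gamma> - 1) \<noteq> 0"
    using c_pos dens_pos[OF assms] stiff_pos[of \<theta>] gamma assms by simp
  then show "(*) ?d \<circ> (*) (inverse ?d) = id"
    by (auto simp: fun_eq_iff)
  show "open {0::real<..}" "\<theta> \<in> {0<..}" using assms by auto
  show "continuous_on {0<..} press"
    using press_deriv by (meson DERIV_isCont continuous_at_imp_continuous_on greaterThan_iff)
qed (simp add: theta_of_press_press)

context
  fixes m p :: "real \<Rightarrow> real" and R :: real
  assumes sol: "tov_solution c G 0 P (ereal R) m p"
    and cd: "has_central_density c G 0 P \<rho>c m p"
    and lim: "(p \<longlongrightarrow> 0) (at_left R)"
begin

lemma R_pos: "0 < R"
  using sol by (simp add: tov_solution_def)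

lemma tov0:
  assumes "0 < r" "r < R"
  shows "p r \<in> P ` {0<..}" "0 < tov_kappa c G 0 r (m r)"
    "(m has_real_derivative 4 * pi * r\<^sup>2 * density_of P (p r)) (at r)"
    "(p has_real_derivative - (density_of P (p r) + p r / c\<^sup>2)
             * (tov_Q c G 0 r (m r) (p r) / (r\<^sup>2 * tov_kappa c G 0 r (m r)))) (at r)"
  using sol assms by (simp_all add: tov_solution_def tov_domain_def)

lemma tov0_theta:
  assumes "0 < r" "r < R"
  shows "0 < theta_of_press (p r)" "press (theta_of_press (p r)) = p r"
    "dens (theta_of_press (p r)) = density_of P (p r)" "0 < p r"
proof -
  show "0 < theta_of_press (p r)" "press (theta_of_press (p r)) = p r"
    "dens (theta_of_press (p r)) = density_of P (p r)"
    using press_theta_of_press[OF tov0(1)[OF assms]] by auto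
  show "0 < p r"
    using tov0(1)[OF assms] P_pos by (elim imageE) simp
qed

lemma tov0_mass_limit: "(m \<longlongrightarrow> 0) (at_right 0)"
proof -
  have "((\<lambda>r. m r - 4 * pi / 3 * \<rho>c * r ^ 3) \<longlongrightarrow> 0) (at_right 0)"
    using cd bigo_power_tendsto_0[of _ 4] by (simp add: has_central_density_def)
  moreover have "((\<lambda>r. 4 * pi / 3 * \<rho>c * r ^ 3) \<longlongrightarrow> 4 * pi / 3 * \<rho>c * 0 ^ 3) (at_right 0)"
    by (intro tendsto_intros)
  ultimately show ?thesis
    using tendsto_add by fastforce
qed

lemma tov0_pressure_limit: "(p \<longlongrightarrow> P \<rho>c) (at_right 0)"
proof -
  let ?q = "\<lambda>r. P \<rho>c - (\<rho>c + P \<rho>c / c\<^sup>2) * (4 * pi * G * (\<rho>c + 3 * P \<rho>c / c\<^sup>2) - c\<^sup>2 * 0) * (r\<^sup>2 / 6)"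
  have "((\<lambda>r. p r - ?q r) \<longlongrightarrow> 0) (at_right 0)"
    using cd bigo_power_tendsto_0[of "\<lambda>r. p r - ?q r" 3] by (simp add: has_central_density_def)
  moreover have "(?q \<longlongrightarrow> ?q 0) (at_right 0)"
    by (intro tendsto_intros) auto
  ultimately have "((\<lambda>r. (p r - ?q r) + ?q r) \<longlongrightarrow> 0 + ?q 0) (at_right 0)"
    by (rule tendsto_add)
  then show ?thesis by simp
qed

text \<open>At the centre the differentiability of \<open>theta_of_press\<close> gives continuity.
  It covers positive pressures only, so at the surface the limit follows from monotonicity: a
  pressure below \<open>press a\<close> forces \<open>\<theta>\<close> below
  \<open>a\<close>.\<close>

lemma tov0_theta_limits:
  "((\<lambda>r. theta_of_press (p r)) \<longlongrightarrow> \<theta>c) (at_right 0)"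
  "((\<lambda>r. theta_of_press (p r)) \<longlongrightarrow> 0) (at_left R)"
proof -
  have "P \<rho>c = press \<theta>c"
    using press_eq[OF \<theta>c_pos] dens_\<theta>c by simp
  then show "((\<lambda>r. theta_of_press (p r)) \<longlongrightarrow> \<theta>c) (at_right 0)"
    using isCont_tendsto_compose[OF DERIV_isCont[OF theta_of_press_deriv[OF \<theta>c_pos]]]
      tov0_pressure_limit theta_of_press_press[OF \<theta>c_pos] by simp
  have ev: "eventually (\<lambda>r. 0 < r \<and> r < R) (at_left R)"
    using R_pos by (auto simp: eventually_at_left_field)
  show "((\<lambda>r. theta_of_press (p r)) \<longlongrightarrow> 0) (at_left R)"
  proof (rule order_tendstoI)
    fix a :: real assume "a < 0"
    show "eventually (\<lambda>r. a < theta_of_press (p r)) (at_left R)"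
      by (rule eventually_mono[OF ev]) (use tov0_theta(1) \<open>a < 0\<close> in \<open>auto intro: less_trans\<close>)
  next
    fix a :: real assume a: "0 < a"
    have "0 < press a"
      using a P_pos dens_pos press_eq by simp
    then have "eventually (\<lambda>r. p r < press a) (at_left R)"
      using lim by (rule order_tendstoD(2)[rotated])
    with ev show "eventually (\<lambda>r. theta_of_press (p r) < a) (at_left R)"
    proof eventually_elim
      case (elim r)
      show ?case
      proof (rule ccontr)
        assume "\<not> theta_of_press (p r) < a"
        then have "press a \<le> press (theta_of_press (p r))"
          using press_strict_mono[OF a, of "theta_of_press (p r)"] by fastforce
        then show False using tov0_theta(2)[of r] elim by simp
      qed
    qed
  qed
qed

lemma tov0_mass_pos:
  assumes "0 < r" "r < R"
  shows "0 < m r"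
proof -
  obtain z where z: "0 < z" "z < r" "m r - 0 = r * (4 * pi * z\<^sup>2 * density_of P (p z))"
    by (rule MVT_right_limit[OF assms(1) tov0_mass_limit tov0(3)]) (use assms in auto)
  have "0 < density_of P (p z)"
    using tov0_theta[of z] dens_pos z assms by (metis less_trans)
  then show ?thesis
    using z assms by simp
qed

lemma tov0_theta_deriv:
  assumes r: "0 < r" "r < R"
  shows "((\<lambda>r. theta_of_press (p r)) has_real_derivative
    - (decay (theta_of_press (p r)) * (tov_Q c G 0 r (m r) (p r) / (r\<^sup>2 * tov_kappa c G 0 r (m r))))) (at r)"
proof -
  let ?t = "theta_of_press (p r)" and ?q = "tov_Q c G 0 r (m r) (p r) / (r\<^sup>2 * tov_kappa c G 0 r (m r))"
  let ?d = "c\<^sup>2 * dens ?t * stiff ?t / (\<gamma> - 1)"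
  note t = tov0_theta[OF r]
  have d: "?d \<noteq> 0"
    using c_pos dens_pos[OF t(1)] stiff_pos[of ?t] t(1) gamma by simp
  have "(theta_of_press has_real_derivative inverse ?d) (at (p r))"
    using theta_of_press_deriv[OF t(1)] t(2) by simp
  from DERIV_chain2[OF this tov0(4)[OF r]]
  have "((\<lambda>r. theta_of_press (p r)) has_real_derivative
      inverse ?d * (- (density_of P (p r) + p r / c\<^sup>2) * ?q)) (at r)" .
  moreover have "density_of P (p r) + p r / c\<^sup>2 = ?d * decay ?t"
    using press_deriv_decay[OF t(1)] t by simp
  then have "inverse ?d * (- (density_of P (p r) + p r / c\<^sup>2) * ?q) = - ((inverse ?d * ?d) * decay ?t * ?q)"
    by (simp only: mult_minus_left mult_minus_right mult.assoc)
  then have "inverse ?d * (- (density_of P (p r) + p r / c\<^sup>2) * ?q) = - (decay ?t * ?q)"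
    unfolding left_inverse[OF d] by simp
  ultimately show ?thesis by simp
qed

text \<open>For \<Lambda> = 0 there is no repulsive term: Q is a sum of positive contributions of
  mass and pressure.\<close>

lemma tov0_force_pos:
  assumes r: "0 < r" "r < R"
  shows "0 < tov_Q c G 0 r (m r) (p r) / (r\<^sup>2 * tov_kappa c G 0 r (m r))"
proof -
  have "0 < tov_Q c G 0 r (m r) (p r)"
    using tov0_mass_pos[OF r] tov0_theta(4)[OF r] r G_pos c_pos
    by (auto simp: tov_Q_def intro!: mult_pos_pos add_pos_pos)
  then show ?thesis
    using tov0(2)[OF r] r by simp
qed

lemma tov0_theta_less:
  assumes "0 < r" "r < R"
  shows "theta_of_press (p r) < \<theta>c"
proof -
  obtain z where z: "0 < z" "z < r" "theta_of_press (p r) - \<theta>c = r *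
      - (decay (theta_of_press (p z)) * (tov_Q c G 0 z (m z) (p z) / (z\<^sup>2 * tov_kappa c G 0 z (m z))))"
    by (rule MVT_right_limit[OF assms(1) tov0_theta_limits(1) tov0_theta_deriv]) (use assms in auto)
  have "0 < decay (theta_of_press (p z)) * (tov_Q c G 0 z (m z) (p z) / (z\<^sup>2 * tov_kappa c G 0 z (m z)))"
    using z assms by (intro mult_pos_pos decay_pos tov0_force_pos less_imp_le[OF tov0_theta(1)]) auto
  then have "theta_of_press (p r) - \<theta>c < 0"
    unfolding z(3) mult_minus_right neg_less_0_iff_less by (rule mult_pos_pos[OF assms(1)])
  then show ?thesis by simp
qed

section \<open>The short star as a solution of the regularised system\<close>

text \<open>Extension by the two one-sided limits, so that the result is continuous on the whole
  line, as the regularised functionals require.\<close>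

definition profile :: "real \<Rightarrow> real" where
  "profile r = (if r \<le> 0 then \<theta>c else if r < R then theta_of_press (p r) else 0)"

lemma profile_0: "profile 0 = \<theta>c" and profile_R: "profile R = 0"
  using R_pos by (simp_all add: profile_def)

lemma profile_bounds:
  assumes "0 < r" "r < R"
  shows "0 < profile r" "profile r < \<theta>c"
    "cdens (profile r) = density_of P (p r)" "cpress (profile r) = p r"
    "cdecay (profile r) = decay (theta_of_press (p r))"
proof -
  have [simp]: "profile r = theta_of_press (p r)" using assms by (simp add: profile_def)
  show "0 < profile r" "profile r < \<theta>c"
    "cdens (profile r) = density_of P (p r)" "cpress (profile r) = p r"
    "cdecay (profile r) = decay (theta_of_press (p r))"
    using tov0_theta[OF assms] tov0_theta_less[OF assms]
    by (simp_all add: cdens_def cpress_def cdecay_def clamp_\<theta>_id)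
qed

lemma continuous_on_profile: "continuous_on UNIV profile"
proof (rule continuous_at_imp_continuous_on, rule ballI)
  fix x :: real
  have l: "(profile \<longlongrightarrow> \<theta>c) (at_left x)" if "x \<le> 0"
    by (rule tendsto_eventually) (use that in \<open>auto simp: eventually_at_filter profile_def\<close>)
  have r: "(profile \<longlongrightarrow> 0) (at_right x)" if "x \<ge> R"
    by (rule tendsto_eventually) (use that R_pos in \<open>auto simp: eventually_at_filter profile_def\<close>)
  have ev: "eventually (\<lambda>r. theta_of_press (p r) = profile r) F"
    if "eventually (\<lambda>r. 0 < r \<and> r < R) F" for F
    by (rule eventually_mono[OF that]) (simp add: profile_def)
  consider "x < 0" | "x = 0" | "0 < x" "x < R" | "x = R" | "R < x" by linarith
  then show "isCont profile x"
  proof cases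
    case 1
    have "eventually (\<lambda>r. profile r = \<theta>c) (nhds x)"
      by (rule eventually_nhds_in_open[of "{..<0}", THEN eventually_mono]) (use 1 in \<open>auto simp: profile_def\<close>)
    then show ?thesis by (subst isCont_cong) auto
  next
    case 2
    have "(profile \<longlongrightarrow> \<theta>c) (at_right 0)"
      by (rule Lim_transform_eventually[OF tov0_theta_limits(1) ev])
        (use R_pos in \<open>auto simp: eventually_at_right_field\<close>)
    then show ?thesis
      using l 2 profile_0 by (simp add: isCont_def filterlim_split_at)
  next
    case 3
    have "isCont (\<lambda>r. theta_of_press (p r)) x"
      by (rule DERIV_isCont[OF tov0_theta_deriv[OF 3]])
    moreover have "eventually (\<lambda>r. theta_of_press (p r) = profile r) (nhds x)"
      by (rule ev, rule eventually_nhds_in_open[of "{0<..<R}", THEN eventually_mono]) (use 3 in auto)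
    ultimately show ?thesis by (subst (asm) isCont_cong) auto
  next
    case 4
    have "(profile \<longlongrightarrow> 0) (at_left R)"
      by (rule Lim_transform_eventually[OF tov0_theta_limits(2) ev])
        (use R_pos in \<open>auto simp: eventually_at_left_field\<close>)
    then show ?thesis
      using r 4 profile_R by (simp add: isCont_def filterlim_split_at)
  next
    case 5
    have "eventually (\<lambda>r. profile r = 0) (nhds x)"
      by (rule eventually_nhds_in_open[of "{R<..}", THEN eventually_mono]) (use 5 R_pos in \<open>auto simp: profile_def\<close>)
    then show ?thesis by (subst isCont_cong) auto
  qed
qed

text \<open>Both sides have the same derivative and tend to 0 at the centre; the mean value theorem
  with the limit at 0 excludes any difference.\<close>

lemma profile_mass:
  assumes r: "0 < r" "r < R"
  shows "m r = r ^ 3 * rmass profile r"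
proof -
  let ?M = "\<lambda>r. r ^ 3 * rmass profile r"
  have M: "(?M \<longlongrightarrow> 0 ^ 3 * rmass profile 0) (at_right 0)"
    by (intro tendsto_intros continuous_on_tendsto_compose[OF continuous_on_rmass[OF continuous_on_profile, of UNIV]]) auto
  have lim0: "((\<lambda>r. m r - ?M r) \<longlongrightarrow> 0) (at_right 0)"
    using tendsto_diff[OF tov0_mass_limit M] by simp
  have "((\<lambda>r. m r - ?M r) has_real_derivative 0) (at s)" if "0 < s" "s \<le> r" for s
  proof -
    have s: "0 < s" "s < R" using that r by auto
    have "(?M has_real_derivative 4 * pi * s\<^sup>2 * cdens (profile s)) (at s)"
      unfolding rmass_def
      by (rule has_real_derivative_scaled_mass[OF continuous_on_cdens_comp[OF continuous_on_profile] s(1)])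
    from DERIV_diff[OF tov0(3)[OF s] this] show ?thesis
      by (simp add: profile_bounds(3)[OF s])
  qed
  from MVT_right_limit[OF r(1) lim0 this] show ?thesis by (metis diff_eq_eq add_0 mult_zero_right diff_zero)
qed

lemma profile_kappa:
  assumes "0 < r" "r < R"
  shows "tov_kappa c G 0 r (m r) = rkappa 0 profile r" "0 < rkappa 0 profile r"
  using rkappa_eq[OF assms(1), of 0 profile] profile_mass[OF assms] tov0(2)[OF assms] by simp_all

lemma profile_deriv:
  assumes r: "0 < r" "r < R"
  shows "(profile has_real_derivative - (r * (cdecay (profile r) * (rforce 0 profile r * inverse (rkappa 0 profile r))))) (at r)"
proof -
  have "((\<lambda>r. theta_of_press (p r)) has_real_derivative
      - (cdecay (profile r) * (r ^ 3 * rforce 0 profile r / (r\<^sup>2 * rkappa 0 profile r)))) (at r)"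
    using tov0_theta_deriv[OF r] rforce_eq[of 0 r profile]
    unfolding profile_kappa(1)[OF r] profile_bounds(4,5)[OF r] profile_mass[OF r, symmetric]
    by simp
  then have "((\<lambda>r. theta_of_press (p r)) has_real_derivative
      - (r * (cdecay (profile r) * (rforce 0 profile r * inverse (rkappa 0 profile r))))) (at r)"
    by (rule DERIV_cong) (use r profile_kappa(2)[OF r] in \<open>simp add: field_simps power2_eq_square power3_eq_cube\<close>)
  then show ?thesis
    by (rule has_field_derivative_transform_within_open[of _ _ _ "{0<..<R}"]) (use r in \<open>auto simp: profile_def\<close>)
qed

lemma profile_force_pos: "0 < rforce 0 profile s"
  using rmass_pos[OF continuous_on_profile profile_0, of s] cpress_nonneg[of "profile s"] G_pos c_pos
  by (auto simp: rforce_def intro!: mult_pos_pos add_pos_nonneg)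

text \<open>If \<open>\<kappa>\<close> vanished at the surface it would do so at least linearly in \<open>R - r\<close>, and then
  \<open>d\<theta>/dr\<close> would drive \<open>\<theta>\<close> to \<open>-\<infinity>\<close> logarithmically.\<close>

lemma profile_kappa_R_pos: "0 < rkappa 0 profile R"
proof (rule ccontr)
  let ?k = "rkappa 0 profile" and ?y = profile
  note y = continuous_on_profile
  assume "\<not> 0 < ?k R"
  moreover have "0 \<le> ?k R"
  proof (rule tendsto_lowerbound)
    show "(?k \<longlongrightarrow> ?k R) (at_left R)"
      by (rule continuous_on_UNIV_tendsto_at_left[OF continuous_on_rkappa[OF y]])
    show "eventually (\<lambda>r. 0 \<le> ?k r) (at_left R)"
      using profile_kappa(2) R_pos by (auto simp: eventually_at_left_field intro!: exI[of _ 0] less_imp_le)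
  qed simp
  ultimately have kR: "?k R = 0" by simp
  \<comment> \<open>The derivative of \<kappa>, obtained by writing \<open>s\<^sup>2 * rmass\<close>
    as the enclosed mass over the radius: the mass has a known derivative, while
    \<open>rmass\<close> is only known to be continuous.\<close>
  let ?k' = "\<lambda>s. - (2 * G / c\<^sup>2 * (4 * pi * s * cdens (?y s) - s * rmass ?y s))"
  have dk: "(?k has_real_derivative ?k' s) (at s)" if s: "0 < s" for s
  proof -
    have "((\<lambda>r. r ^ 3 * rmass ?y r) has_real_derivative 4 * pi * s\<^sup>2 * cdens (?y s)) (at s)"
      unfolding rmass_def by (rule has_real_derivative_scaled_mass[OF continuous_on_cdens_comp[OF y] s])
    then have "((\<lambda>r. 1 - 2 * G / c\<^sup>2 * ((r ^ 3 * rmass ?y r) / r)) has_real_derivative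
        0 - 2 * G / c\<^sup>2 * ((4 * pi * s\<^sup>2 * cdens (?y s) * s - s ^ 3 * rmass ?y s * 1) / (s * s))) (at s)"
      using s by (intro DERIV_diff DERIV_const DERIV_cmult DERIV_divide DERIV_ident) auto
    then have "((\<lambda>r. 1 - 2 * G / c\<^sup>2 * ((r ^ 3 * rmass ?y r) / r)) has_real_derivative ?k' s) (at s)"
      by (rule DERIV_cong) (use s c_pos in \<open>simp add: field_simps power2_eq_square power3_eq_cube\<close>)
    then show ?thesis
      by (rule has_field_derivative_transform_within_open[of _ _ _ "{0<..}"])
        (use s in \<open>auto simp: rkappa_def power2_eq_square power3_eq_cube\<close>)
  qed
  have "continuous_on {R/2..R} ?k'"
    by (intro continuous_intros continuous_on_cdens_comp continuous_on_rmass y)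
  then obtain B where B: "\<And>s. R/2 \<le> s \<Longrightarrow> s \<le> R \<Longrightarrow> \<bar>?k' s\<bar> \<le> B"
    by (rule continuous_on_interval_bounded) blast
  define C where "C = \<bar>B\<bar> + 1"
  have C0: "0 < C" by (simp add: C_def)
  have kC: "?k s \<le> C * (R - s)" if s: "R/2 \<le> s" "s \<le> R" for s
  proof -
    have "norm (?k s - ?k R) \<le> C * norm (s - R)"
    proof (rule field_differentiable_bound[of "{R/2..R}" ?k ?k'])
      show "(?k has_real_derivative ?k' z) (at z within {R/2..R})" if "z \<in> {R/2..R}" for z
        using dk[of z] that R_pos by (auto intro: has_field_derivative_at_within)
      show "norm (?k' z) \<le> C" if "z \<in> {R/2..R}" for z
        using B[of z] that by (simp add: C_def)
    qed (use s R_pos in auto)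
    then show ?thesis using kR s by simp
  qed
  let ?h = "\<lambda>s. s * (cdecay (?y s) * rforce 0 ?y s)"
  have "continuous_on {R/2..R} ?h"
    by (intro continuous_intros continuous_on_cdecay_comp continuous_on_rforce y)
  then obtain s0 where s0: "s0 \<in> {R/2..R}" "\<And>s. s \<in> {R/2..R} \<Longrightarrow> ?h s0 \<le> ?h s"
    using continuous_attains_inf[of "{R/2..R}" ?h] R_pos by auto
  \<comment> \<open>On the outer half of the star \<kappa> is at most \<open>C * (R - s)\<close> and
    the numerator at least \<open>?h s0\<close>, whence d\<theta>/ds is at most
    \<open>- a / (R - s)\<close>.\<close>
  define a where "a = ?h s0 / C"
  have a0: "0 < a"
    using s0(1) R_pos C0 cdecay_pos profile_force_pos by (simp add: a_def)
  \<comment> \<open>The integrated form of that inequality is that \<open>?H\<close> does not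
    increase.\<close>
  let ?H = "\<lambda>s. ?y s - a * ln (R - s)"
  have H: "?H s \<le> ?H (R/2)" if s: "R/2 \<le> s" "s < R" for s
  proof (rule DERIV_nonpos_imp_nonincreasing[OF s(1)])
    fix t assume t: "R/2 \<le> t" "t \<le> s"
    have tR: "0 < t" "t < R" using t s R_pos by auto
    have "(?H has_real_derivative - (t * (cdecay (?y t) * (rforce 0 ?y t * inverse (?k t)))) - a * (inverse (R - t) * (0 - 1))) (at t)"
      by (intro DERIV_diff profile_deriv[OF tR] DERIV_cmult DERIV_chain2[OF DERIV_ln] DERIV_const DERIV_ident) (use tR in simp)
    moreover have "a * inverse (R - t) \<le> t * (cdecay (?y t) * (rforce 0 ?y t * inverse (?k t)))"
    proof -
      have "a * inverse (R - t) = ?h s0 * inverse (C * (R - t))"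
        by (simp add: a_def divide_inverse)
      also have "\<dots> \<le> ?h t * inverse (?k t)"
      proof (rule mult_mono)
        show "?h s0 \<le> ?h t" using s0(2)[of t] t s by simp
        show "inverse (C * (R - t)) \<le> inverse (?k t)"
          using kC[of t] t s profile_kappa(2)[OF tR] by (intro le_imp_inverse_le) auto
        show "0 \<le> ?h t"
          using tR cdecay_pos profile_force_pos by (intro mult_nonneg_nonneg less_imp_le) auto
        show "0 \<le> inverse (C * (R - t))"
          using C0 tR by simp
      qed
      finally show ?thesis by (simp add: mult.assoc)
    qed
    ultimately show "\<exists>D. (?H has_real_derivative D) (at t) \<and> D \<le> 0"
      by (intro exI conjI) auto
  qed
  \<comment> \<open>So small that \<open>a * ln d \<le> - ?H (R/2)\<close>. Then
    \<open>?y (R - d)\<close> is at most 0, although \<open>R - d\<close> lies inside the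
    star.\<close>
  define d where "d = min (R/2) (exp (- (?H (R/2) / a)))"
  have d: "0 < d" "d \<le> R/2" "d \<le> exp (- (?H (R/2) / a))"
    using R_pos by (auto simp: d_def)
  have "ln d \<le> - (?H (R/2) / a)"
    using d by (metis ln_exp ln_le_cancel_iff exp_gt_zero)
  then have "a * ln d \<le> - ?H (R/2)"
    using a0 by (simp add: field_simps)
  moreover have "0 < ?y (R - d)"
    using profile_bounds(1)[of "R - d"] d R_pos by simp
  moreover have "?y (R - d) - a * ln d \<le> ?H (R/2)"
    using H[of "R - d"] d by simp
  ultimately show False by linarith
qed

end

lemma short_star_profile:
  assumes "short_tov c G P \<rho>c"
  obtains y R where "0 < R" "continuous_on UNIV y" "y 0 = \<theta>c" "y R = 0"
    and "\<And>r. 0 < r \<Longrightarrow> r < R \<Longrightarrow> 0 < y r \<and> y r < \<theta>c"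
    and "\<And>r. 0 \<le> r \<Longrightarrow> r \<le> R \<Longrightarrow> 0 < rkappa 0 y r"
    and "\<And>r. 0 < r \<Longrightarrow> r < R \<Longrightarrow> (y has_real_derivative
      - (r * (cdecay (y r) * (rforce 0 y r * inverse (rkappa 0 y r))))) (at r)"
proof -
  obtain R m p where *: "tov_solution c G 0 P (ereal R) m p" "has_central_density c G 0 P \<rho>c m p"
    "(p \<longlongrightarrow> 0) (at_left R)"
    using assms by (auto simp: short_tov_def germ_prolongation_def)
  show ?thesis
  proof (rule that[of R "profile p R"])
    show "0 < rkappa 0 (profile p R) r" if "0 \<le> r" "r \<le> R" for r
      using profile_kappa(2)[OF *, of r] profile_kappa_R_pos[OF *] that
      by (cases "r = 0"; cases "r = R") (auto simp: rkappa_def)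
  qed (use R_pos[OF *] continuous_on_profile[OF *] profile_0[OF *] profile_R[OF *] profile_bounds(1,2)[OF *]
      profile_deriv[OF *] in auto)
qed

section \<open>Perturbation in \<open>\<Lambda>\<close>\<close>

text \<open>A continuation beyond \<open>R\<close> would be continuous there with a pressure in the
  range of P, hence positive, whereas its limit from the left is 0.\<close>

lemma germ_prolongation_short:
  assumes sol: "tov_solution c G \<Lambda> P (ereal R) m p" and cd: "has_central_density c G \<Lambda> P \<rho>c m p"
    and lim: "(p \<longlongrightarrow> 0) (at_left R)"
  shows "germ_prolongation c G \<Lambda> P \<rho>c (ereal R) m p"
  unfolding germ_prolongation_def
proof (intro conjI sol cd notI)
  assume "\<exists>R' m' p'. ereal R < R' \<and> tov_solution c G \<Lambda> P R' m' p' \<and>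
    (\<forall>r. 0 < r \<and> ereal r < ereal R \<longrightarrow> m' r = m r \<and> p' r = p r)"
  then obtain R' m' p' where R': "ereal R < R'" and sol': "tov_solution c G \<Lambda> P R' m' p'"
    and eq: "\<And>r. 0 < r \<Longrightarrow> r < R \<Longrightarrow> p' r = p r" by auto
  have R: "0 < R" using sol by (simp add: tov_solution_def)
  have "p' R \<in> P ` {0<..}" "isCont p' R"
    using sol' R R' by (auto simp: tov_solution_def tov_domain_def intro: DERIV_isCont)
  then have pR: "0 < p' R" "(p' \<longlongrightarrow> p' R) (at_left R)"
    by (elim imageE, use P_pos in simp, simp add: isCont_def filterlim_at_split)
  have "(p' \<longlongrightarrow> 0) (at_left R)"
    by (rule Lim_transform_eventually[OF lim])
      (use R eq in \<open>auto simp: eventually_at_left_field intro!: exI[of _ 0]\<close>)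
  then show False
    using tendsto_unique[OF _ pR(2)] pR(1) by fastforce
qed

lemma regular_monotone_short:
  assumes y: "continuous_on UNIV y" and k: "0 < k" "k \<le> 1" and \<Lambda>: "\<bar>\<Lambda>\<bar> \<le> 1"
    and y0: "y 0 = \<theta>c" and yR0: "y R = 0" and R: "0 < R"
    and yR: "\<And>r. 0 < r \<Longrightarrow> r < R \<Longrightarrow> 0 < y r \<and> y r < \<theta>c"
    and kR: "\<And>r. 0 < r \<Longrightarrow> r \<le> R \<Longrightarrow> k < rkappa \<Lambda> y r"
    and FR: "\<And>r. 0 < r \<Longrightarrow> r \<le> R \<Longrightarrow> 0 < rforce \<Lambda> y r"
    and der: "\<And>r. 0 < r \<Longrightarrow> r < R \<Longrightarrow> (y has_real_derivative rhs k \<Lambda> y r) (at r)"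
  shows "\<exists>m p. germ_prolongation c G \<Lambda> P \<rho>c (ereal R) m p \<and> monotone_short c G \<Lambda> P R m p"
proof -
  let ?m = "\<lambda>r. r ^ 3 * rmass y r" and ?p = "\<lambda>r. cpress (y r)"
  have kR': "k < rkappa \<Lambda> y r" if "0 < r" "r < R" for r using kR that by simp
  note ctx = y k y0 R yR kR' der
  have sol: "tov_solution c G \<Lambda> P (ereal R) ?m ?p"
    by (rule regular_tov_solution[OF ctx])
  have cd: "has_central_density c G \<Lambda> P \<rho>c ?m ?p"
    by (rule regular_has_central_density[OF ctx \<Lambda>])
  have "cpress 0 = 0"
    using \<theta>c_pos by (simp add: cpress_def clamp_\<theta>_id)
  then have lim: "(?p \<longlongrightarrow> 0) (at_left R)"
    using continuous_on_UNIV_tendsto_at_left[OF continuous_on_cpress_comp[OF y], of R] yR0 by simp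
  have ev: "eventually (\<lambda>r. 0 < r) (at_left R)"
    using R by (auto simp: eventually_at_left_field)
  have "monotone_short c G \<Lambda> P R ?m ?p"
    unfolding monotone_short_def
  proof (intro conjI sol lim allI impI exI)
    show "(?m \<longlongrightarrow> R ^ 3 * rmass y R) (at_left R)"
      by (intro continuous_on_UNIV_tendsto_at_left continuous_intros continuous_on_rmass y)
    show "((\<lambda>r. tov_kappa c G \<Lambda> r (?m r)) \<longlongrightarrow> rkappa \<Lambda> y R) (at_left R)"
      by (rule Lim_transform_eventually[OF continuous_on_UNIV_tendsto_at_left[OF continuous_on_rkappa[OF y]]],
          rule eventually_mono[OF ev]) (simp add: rkappa_eq)
    show "((\<lambda>r. tov_Q c G \<Lambda> r (?m r) (?p r)) \<longlongrightarrow> R ^ 3 * rforce \<Lambda> y R) (at_left R)"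
      unfolding rforce_eq
      by (intro continuous_on_UNIV_tendsto_at_left continuous_intros continuous_on_rforce y)
    show "0 < rkappa \<Lambda> y R" using kR[of R] R k by simp
    show "0 < R ^ 3 * rforce \<Lambda> y R" using FR[of R] R by simp
    fix r assume "0 < r \<and> r < R"
    then have r: "0 < r" "r < R" by auto
    have "0 < cdens (y r)"
      using clamped_inactive(1)[OF ctx r] dens_pos yR[OF r] by simp
    then have "0 < cdens (y r) + ?p r / c\<^sup>2"
      using cpress_nonneg[of "y r"] by (simp add: add_pos_nonneg)
    then have "0 < r * ((cdens (y r) + ?p r / c\<^sup>2) * (rforce \<Lambda> y r * inverse (max k (rkappa \<Lambda> y r))))"
      using r FR[of r] k by (intro mult_pos_pos) auto
    then show "deriv ?p r < 0"
      using DERIV_imp_deriv[OF regular_pressure_deriv[OF ctx r]] by simp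
  qed
  then show ?thesis
    using germ_prolongation_short[OF sol cd lim] by blast
qed

lemma rhs_neg:
  assumes "0 < s" "0 < k" "0 < rforce \<Lambda> y s"
  shows "rhs k \<Lambda> y s < 0"
proof -
  have "0 < s * (cdecay (y s) * (rforce \<Lambda> y s * inverse (max k (rkappa \<Lambda> y s))))"
    using assms cdecay_pos by (intro mult_pos_pos) auto
  then show ?thesis by (simp add: rhs_def)
qed

lemma regular_solution_decreasing:
  assumes y: "continuous_on UNIV y" and k: "0 < k"
    and eq: "\<And>r. 0 \<le> r \<Longrightarrow> r \<le> T \<Longrightarrow> y r = \<theta>c + integral {0..r} (rhs k \<Lambda> y)"
    and pos: "\<And>r. 0 < r \<Longrightarrow> r < T \<Longrightarrow> 0 < rforce \<Lambda> y r"
    and st: "0 \<le> s" "s < t" "t \<le> T"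
  shows "y t < y s"
proof (rule DERIV_neg_imp_decreasing_open[OF st(2)])
  fix r assume "s < r" "r < t"
  then have r: "0 < r" "r < T" using st by auto
  show "\<exists>D. (y has_real_derivative D) (at r) \<and> D < 0"
    using regular_solution_deriv[OF y k eq r] rhs_neg[OF r(1) k pos[OF r]] by blast
qed (rule continuous_on_subset[OF y], simp)

section \<open>Persistence of the surface for small \<Lambda>\<close>

lemma short_imp_monotone_short:
  assumes "short_tov c G P \<rho>c"
  shows "\<exists>\<epsilon>1>0. \<forall>\<Lambda>. 0 < \<Lambda> \<and> \<Lambda> \<le> \<epsilon>1 \<longrightarrow>
           (\<exists>R m p. germ_prolongation c G \<Lambda> P \<rho>c (ereal R) m p \<and> monotone_short c G \<Lambda> P R m p)"
proof -
  obtain z R where R: "0 < R" and z: "continuous_on UNIV z" "z 0 = \<theta>c" "z R = 0"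
    and zk: "\<And>r. 0 \<le> r \<Longrightarrow> r \<le> R \<Longrightarrow> 0 < rkappa 0 z r"
    and zd: "\<And>r. 0 < r \<Longrightarrow> r < R \<Longrightarrow> (z has_real_derivative
      - (r * (cdecay (z r) * (rforce 0 z r * inverse (rkappa 0 z r))))) (at r)"
    by (rule short_star_profile[OF assms]) blast
  obtain r0 where r0: "0 \<le> r0" "r0 \<le> R" "\<And>r. 0 \<le> r \<Longrightarrow> r \<le> R \<Longrightarrow> rkappa 0 z r0 \<le> rkappa 0 z r"
    using continuous_attains_inf[OF compact_Icc, of 0 R "rkappa 0 z"] continuous_on_rkappa[OF z(1)] R by auto
  \<comment> \<open>Half the minimum of \<kappa> on the closed star. The margin is spent in two
    equal steps: \<open>2 * k\<close> up to the surface, more than \<open>3 / 2 * k\<close> slightly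
    beyond it, more than \<open>k\<close> after the perturbation.\<close>
  define k where "k = rkappa 0 z r0 / 2"
  have k0: "0 < k" using zk[OF r0(1,2)] by (simp add: k_def)
  have zk2: "2 * k \<le> rkappa 0 z r" if "0 \<le> r" "r \<le> R" for r
    using r0(3)[OF that] by (simp add: k_def)
  have k1: "k \<le> 1" using zk2[of 0] R by (simp add: rkappa_def)
  \<comment> \<open>Any number above \<open>R\<close> would do; the solutions must extend beyond the
    surface.\<close>
  define T where "T = R + 1"
  have T: "0 \<le> T" "R < T" using R by (simp_all add: T_def)
  obtain L where L: "0 < L"
    and Lr: "\<And>\<Lambda> \<Lambda>' y z s E. \<lbrakk>\<bar>\<Lambda>\<bar> \<le> 1; \<bar>\<Lambda>'\<bar> \<le> 1; continuous_on UNIV y; continuous_on UNIV z; 0 \<le> s; s \<le> T;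
      \<And>t. 0 \<le> t \<Longrightarrow> t \<le> s \<Longrightarrow> \<bar>y t - z t\<bar> \<le> E\<rbrakk> \<Longrightarrow>
      \<bar>rhs k \<Lambda> y s - rhs k \<Lambda>' z s\<bar> \<le> L * (E + \<bar>\<Lambda> - \<Lambda>'\<bar>)"
    and LF: "\<And>\<Lambda> \<Lambda>' y z s E. \<lbrakk>\<bar>\<Lambda>\<bar> \<le> 1; \<bar>\<Lambda>'\<bar> \<le> 1; continuous_on UNIV y; continuous_on UNIV z; 0 \<le> s; s \<le> T;
      \<And>t. 0 \<le> t \<Longrightarrow> t \<le> s \<Longrightarrow> \<bar>y t - z t\<bar> \<le> E\<rbrakk> \<Longrightarrow>
      \<bar>rforce \<Lambda> y s - rforce \<Lambda>' z s\<bar> \<le> L * (E + \<bar>\<Lambda> - \<Lambda>'\<bar>)"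
    and LK: "\<And>\<Lambda> \<Lambda>' y z s E. \<lbrakk>\<bar>\<Lambda>\<bar> \<le> 1; \<bar>\<Lambda>'\<bar> \<le> 1; continuous_on UNIV y; continuous_on UNIV z; 0 \<le> s; s \<le> T;
      \<And>t. 0 \<le> t \<Longrightarrow> t \<le> s \<Longrightarrow> \<bar>y t - z t\<bar> \<le> E\<rbrakk> \<Longrightarrow>
      \<bar>rkappa \<Lambda> y s - rkappa \<Lambda>' z s\<bar> \<le> L * (E + \<bar>\<Lambda> - \<Lambda>'\<bar>)"
    by (rule rhs_perturbation[OF T(1) k0]) blast
  \<comment> \<open>The length \<open>S\<close> is left free: \<open>S = R\<close> with equal
    constants yields uniqueness on the star, and \<open>S = T\<close> yields continuous dependence
    on \<Lambda>.\<close>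
  have stab: "\<bar>u r - v r\<bar> \<le> 2 * (L * \<bar>\<Lambda> - \<Lambda>'\<bar>) * S * exp (2 * L * S)"
    if \<Lambda>: "\<bar>\<Lambda>\<bar> \<le> 1" "\<bar>\<Lambda>'\<bar> \<le> 1" and S: "0 \<le> S" "S \<le> T"
      and u: "continuous_on UNIV u" "\<And>r. 0 \<le> r \<Longrightarrow> r \<le> S \<Longrightarrow> u r = \<theta>c + integral {0..r} (rhs k \<Lambda> u)"
      and v: "continuous_on UNIV v" "\<And>r. 0 \<le> r \<Longrightarrow> r \<le> S \<Longrightarrow> v r = \<theta>c + integral {0..r} (rhs k \<Lambda>' v)"
      and r: "0 \<le> r" "r \<le> S"
    for \<Lambda> \<Lambda>' S u v r
  proof (rule volterra_stability[where g = "rhs k \<Lambda>" and h = "rhs k \<Lambda>'" and a = \<theta>c, OF S(1) L continuous_on_rhs[OF _ k0] _ u(1) v(1) continuous_on_rhs[OF v(1) k0] u(2) v(2) _ r])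
    show "\<bar>rhs k \<Lambda> f s - rhs k \<Lambda> g s\<bar> \<le> L * E"
      if "continuous_on UNIV f" "continuous_on UNIV g" "0 \<le> s" "s \<le> S"
        "\<And>t. 0 \<le> t \<Longrightarrow> t \<le> s \<Longrightarrow> \<bar>f t - g t\<bar> \<le> E" for f g s E
      using Lr[OF \<Lambda>(1) \<Lambda>(1) that(1-3) _ that(5)] that(4) S by simp
    show "\<bar>rhs k \<Lambda> v s - rhs k \<Lambda>' v s\<bar> \<le> L * \<bar>\<Lambda> - \<Lambda>'\<bar>" if "0 \<le> s" "s \<le> S" for s
      using Lr[OF \<Lambda> v(1) v(1) that(1), of 0] that(2) S by simp
  qed
  \<comment> \<open>The profile \<open>z\<close> is frozen at 0 beyond \<open>R\<close>. Its true
    continuation is \<open>w\<close>, which agrees with \<open>z\<close> on \<open>{0..R}\<close> by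
    uniqueness, since the cut-off is inactive there.\<close>
  obtain w where w: "continuous_on UNIV w"
    and weq: "\<And>r. 0 \<le> r \<Longrightarrow> r \<le> T \<Longrightarrow> w r = \<theta>c + integral {0..r} (rhs k 0 w)"
    by (rule regular_solution_exists[OF T(1) k0, of 0]) auto
  have zeq: "z r = \<theta>c + integral {0..r} (rhs k 0 z)" if r: "0 \<le> r" "r \<le> R" for r
  proof -
    have "(rhs k 0 z has_integral z r - z 0) {0..r}"
    proof (rule fundamental_theorem_of_calculus_interior[OF r(1) continuous_on_subset[OF z(1)]])
      fix s assume s: "s \<in> {0<..<r}"
      then have "max k (rkappa 0 z s) = rkappa 0 z s"
        using zk2[of s] r k0 by simp
      then show "(z has_vector_derivative rhs k 0 z s) (at s)"
        using zd[of s] s r by (simp add: rhs_def has_real_derivative_iff_has_vector_derivative)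
    qed simp
    then show ?thesis using z(2) by (simp add: integral_unique)
  qed
  have wz: "w r = z r" if "0 \<le> r" "r \<le> R" for r
    using stab[of 0 0 R w z r] that R T w weq z(1) zeq by simp
  have wk: "2 * k \<le> rkappa 0 w r" if "0 \<le> r" "r \<le> R" for r
    using LK[of 0 0 w z r 0] zk2[OF that] that w z(1) wz T by simp
  have w0: "w 0 = \<theta>c" and wR: "w R = 0"
    using wz[of 0] wz[of R] z R by auto
  have wF: "0 < rforce 0 w s" for s
    using rmass_pos[OF w w0, of s] cpress_nonneg[of "w s"] G_pos c_pos
    by (auto simp: rforce_def intro!: mult_pos_pos add_pos_nonneg)
  obtain r1 where r1: "R < r1" "r1 < T" and r1k: "\<And>r. 0 \<le> r \<Longrightarrow> r \<le> r1 \<Longrightarrow> 3 / 2 * k < rkappa 0 w r"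
  proof -
    have "isCont (rkappa 0 w) R"
      using continuous_on_rkappa[OF w, of UNIV 0] by (simp add: continuous_on_eq_continuous_at)
    then have "(rkappa 0 w \<longlongrightarrow> rkappa 0 w R) (at_right R)"
      by (simp add: isCont_def filterlim_at_split)
    then have "eventually (\<lambda>r. 3 / 2 * k < rkappa 0 w r) (at_right R)"
      by (rule order_tendstoD) (use wk[of R] R k0 in simp)
    then obtain b where b: "R < b" "\<And>r. R < r \<Longrightarrow> r < b \<Longrightarrow> 3 / 2 * k < rkappa 0 w r"
      by (auto simp: eventually_at_right_field)
    define q where "q = (R + min b T) / 2"
    have "R < q" "q < T" "q < b"
      using b(1) T by (auto simp: q_def)
    moreover have "3 / 2 * k < rkappa 0 w r" if "0 \<le> r" "r \<le> q" for r
      using wk[of r] b(2)[of r] that \<open>q < b\<close> k0 by (cases "r \<le> R") auto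
    ultimately show ?thesis using that by blast
  qed
  have wr1: "w r1 < 0"
  proof -
    have "w r1 < w R"
      by (rule regular_solution_decreasing[OF w k0 weq wF]) (use r1 R in auto)
    then show ?thesis by (simp add: wR)
  qed
  have "{0..T} \<noteq> {}" using T(1) by simp
  from continuous_attains_inf[OF compact_Icc this continuous_on_rforce[OF w]]
  obtain s0 where "\<forall>s\<in>{0..T}. rforce 0 w s0 \<le> rforce 0 w s" by blast
  then have s0: "rforce 0 w s0 \<le> rforce 0 w s" if "0 \<le> s" "s \<le> T" for s
    using that by simp
  \<comment> \<open>The stability bound with \<Lambda> factored out. In \<open>B\<close> the summand
    \<open>C\<close> controls \<open>\<theta>\<close>, \<open>L * (C + 1)\<close> controls both
    \<open>rforce\<close> and \<open>rkappa\<close>, and 1 ensures positivity.\<close>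
  define C where "C = 2 * L * T * exp (2 * L * T)"
  have C0: "0 \<le> C" using L T by (simp add: C_def)
  define B where "B = C + L * (C + 1) + 1"
  \<comment> \<open>The three margins of \<open>w\<close>: the least force on \<open>{0..T}\<close>,
    the gap between \<open>3 / 2 * k\<close> and \<open>k\<close>, and the depth of
    \<open>\<theta>\<close> below zero at \<open>r1\<close>.\<close>
  define \<delta> where "\<delta> = min (rforce 0 w s0) (min (k / 2) (- w r1))"
  have B0: "0 < B" using C0 L by (simp add: B_def add_nonneg_pos)
  have \<delta>_le: "\<delta> \<le> rforce 0 w s0" "\<delta> \<le> k / 2" "\<delta> \<le> - w r1"
    by (simp_all add: \<delta>_def)
  have \<delta>0: "0 < \<delta>" using wF k0 wr1 by (simp add: \<delta>_def)
  \<comment> \<open>The 1 keeps \<Lambda> in the range of the uniform estimates; the factor 2 makes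
    the deviations strictly smaller than \<open>\<delta>\<close>.\<close>
  define \<epsilon> where "\<epsilon> = min 1 (\<delta> / (2 * B))"
  have \<epsilon>0: "0 < \<epsilon>" using \<delta>0 B0 by (simp add: \<epsilon>_def)
  have "\<exists>R m p. germ_prolongation c G \<Lambda> P \<rho>c (ereal R) m p \<and> monotone_short c G \<Lambda> P R m p"
    if \<Lambda>: "0 < \<Lambda>" "\<Lambda> \<le> \<epsilon>" for \<Lambda>
  proof -
    have \<Lambda>1: "\<bar>\<Lambda>\<bar> \<le> 1" using \<Lambda> by (simp add: \<epsilon>_def)
    have "\<Lambda> \<le> \<delta> / (2 * B)" using \<Lambda> by (simp add: \<epsilon>_def)
    then have "B * \<Lambda> \<le> \<delta> / 2"
      using B0 by (simp add: field_simps)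
    then have small: "C * \<Lambda> < \<delta>" "L * (C * \<Lambda> + \<Lambda>) < \<delta>"
    proof -
      have "0 \<le> C * \<Lambda>" "0 \<le> L * (C * \<Lambda> + \<Lambda>)" using C0 L \<Lambda> by auto
      moreover have "B * \<Lambda> = C * \<Lambda> + L * (C * \<Lambda> + \<Lambda>) + \<Lambda>"
        by (simp add: B_def algebra_simps)
      ultimately show "C * \<Lambda> < \<delta>" "L * (C * \<Lambda> + \<Lambda>) < \<delta>"
        using \<open>B * \<Lambda> \<le> \<delta> / 2\<close> \<delta>0 \<Lambda>(1) by linarith+
    qed
    obtain y where y: "continuous_on UNIV y"
      and yeq: "\<And>r. 0 \<le> r \<Longrightarrow> r \<le> T \<Longrightarrow> y r = \<theta>c + integral {0..r} (rhs k \<Lambda> y)"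
      by (rule regular_solution_exists[OF T(1) k0 \<Lambda>1]) blast
    have close: "\<bar>y r - w r\<bar> \<le> C * \<Lambda>" if "0 \<le> r" "r \<le> T" for r
      using stab[OF \<Lambda>1, of 0 T y w r] that T w weq y yeq \<Lambda> by (simp add: C_def mult_ac)
    have yF: "0 < rforce \<Lambda> y r" if "0 \<le> r" "r \<le> T" for r
    proof -
      have "\<bar>rforce \<Lambda> y r - rforce 0 w r\<bar> \<le> L * (C * \<Lambda> + \<bar>\<Lambda> - 0\<bar>)"
        by (rule LF[OF \<Lambda>1 _ y w that]) (use close that in auto)
      then show ?thesis
        unfolding diff_zero abs_of_pos[OF \<Lambda>(1)] using small(2) s0[OF that] \<delta>_le(1) by linarith
    qed
    have yk: "k < rkappa \<Lambda> y r" if r: "0 \<le> r" "r \<le> r1" for r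
    proof -
      have "\<bar>rkappa \<Lambda> y r - rkappa 0 w r\<bar> \<le> L * (C * \<Lambda> + \<bar>\<Lambda> - 0\<bar>)"
        by (rule LK[OF \<Lambda>1 _ y w r(1)]) (use close r r1 in auto)
      then show ?thesis
        unfolding diff_zero abs_of_pos[OF \<Lambda>(1)] using small(2) r1k[OF r] \<delta>_le(2) by linarith
    qed
    have dec: "y t < y s" if "0 \<le> s" "s < t" "t \<le> T" for s t
      by (rule regular_solution_decreasing[OF y k0 yeq _ that]) (use yF in auto)
    have y0: "y 0 = \<theta>c" using yeq[of 0] T by simp
    have "y r1 < 0"
      using close[of r1] small(1) \<delta>_le(3) r1 R by simp
    \<comment> \<open>The surface of the perturbed star; strict decrease of \<open>y\<close> makes
      this its first zero.\<close>
    then obtain q where q: "0 \<le> q" "q \<le> r1" "y q = 0"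
      using IVT2'[of y r1 0 0] y0 \<theta>c_pos r1 R continuous_on_subset[OF y] by auto
    have q0: "0 < q" using q y0 \<theta>c_pos by (cases "q = 0") auto
    have "\<exists>m p. germ_prolongation c G \<Lambda> P \<rho>c (ereal q) m p \<and> monotone_short c G \<Lambda> P q m p"
    proof (rule regular_monotone_short[OF y k0 k1 \<Lambda>1 y0 q(3) q0])
      fix r assume r: "0 < r" "r < q"
      show "0 < y r \<and> y r < \<theta>c"
        using dec[of r q] dec[of 0 r] r q y0 r1 by auto
      show "(y has_real_derivative rhs k \<Lambda> y r) (at r)"
        by (rule regular_solution_deriv[OF y k0 yeq r(1)]) (use r q r1 in auto)
    qed (use yk yF q r1 in auto)
    then show ?thesis by blast
  qed
  with \<epsilon>0 show ?thesis by blast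
qed

end

theorem theorem2:
  fixes c G A \<gamma> \<rho>c :: real and \<Omega> P :: "real \<Rightarrow> real"
  assumes "0 < c" and "0 < G"
    and "pressure_law c A \<gamma> \<Omega> P"
    and "0 < \<rho>c"
    and "short_tov c G P \<rho>c"
  shows "\<exists>\<epsilon>1>0. \<forall>\<Lambda>. 0 < \<Lambda> \<and> \<Lambda> \<le> \<epsilon>1 \<longrightarrow>
           (\<exists>R m p. germ_prolongation c G \<Lambda> P \<rho>c (ereal R) m p \<and> monotone_short c G \<Lambda> P R m p)"
proof -
  interpret star c G A \<gamma> \<rho>c \<Omega> P
    by unfold_locales (use assms in auto)
  show ?thesis
    by (rule short_imp_monotone_short[OF assms(5)])
qed

end
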